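(* The measure $\ell$ is incomparable with the repetitiveness measures $\delta,\gamma,b,v,c,g_{rl},z,z_{no},z_e$ and $r$; that is, for each $\mu\in\{\delta,\gamma,b,v,c,g_{rl},z,z_{no},z_e,r\}$ there exists a string family on which $\ell=o(\mu)$, and there exists a string family on which $\mu=o(\ell)$. On the other hand, it holds (for every string family) that $\ell=O(g)$ and $\ell=\Omega(\nu)$ (these two bounds being known from earlier work).
   Context: A string family is an infinite set of finite strings of unbounded length; asymptotic notation on a family refers to strings $w$ of the family with $n=|w|\to\infty$ (with constants uniform over the family). $w[i:j]$ denotes the substring of $w$ from position $i$ to position $j$ (positions start at 1), and $w[:i]=w[1:i]$. L-systems: an L-system is a tuple $(\Sigma,\varphi,\tau,s,d,n)$, where $\Sigma$ is a finite alphabet, $\varphi:\Sigma^*\to\Sigma^*$ is a non-erasing monoid endomorphism (each rule $a\to\varphi(a)$, $a\in\Sigma$, has $|\varphi(a)|\ge 1$), $\tau:\Sigma^*\to\Sigma^*$ is a coding (a morphism with $|\tau(a)|=1$ for all $a\in\Sigma$), $s\in\Sigma^+$ is the axiom, and $d\ge 0$, $n\ge 1$ are integers. It generates the unique string $\tau(\varphi^d(s))[1:n]$ of length $n$. It is always assumed that $d=n^{O(1)}$ and $|\Sigma|=n^{O(1)}$ (space is measured in $O(\log n)$-bit words). The size of the L-system is $\sum_{a\in\Sigma}|\varphi(a)|+|s|+|\Sigma|+2$. The measure $\ell(w)$ is the size of the smallest L-system generating $w$. NU-systems: a NU-system is a tuple $(V,R,\tau,s,d,n)$ (alphabet, rules,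 coding, axiom, number of levels, prefix length) that generates a unique string in a similar way to an L-system, except that the right-hand sides of its rules (and the axiom) may also contain extraction symbols of the form $a(k)[i:j]$ with $a\in V$, whose meaning is: generate the $k$-th level from $a$, then extract its substring from position $i$ to position $j$, and finally apply the coding to the resulting substring. The indexes in the system (levels, interval endpoints) must be at most $n$, so that they fit in an $O(\log n)$-bit word, and the system must not produce any loops when extracting a prefix from some level. Its size is defined analogously to that of L-systems, with each extraction symbol $a(k)[i:j]$ counted as having length 4. The measure $\nu(w)$ is the size of the smallest NU-system generating $w$. Other measures of a string $w$ of length $n$ ($\gamma$, $v$ and $c$ are given by their standard definitions from the literature): - $\delta(w)=\max\{P_w(k)/k : 1\le k\le n\}$, where $P_w(k)$ is the number of distinct substrings of $w$ of length $k$. - $\gamma(w)$ is the size of the smallest string attractor of $w$: a set $\Gamma\subseteq[1..n]$ of positions such that every non-empty substring of $w$ has an occurrence $w[i:j]$ with $i\le p\le j$ for some $p\in\Gamma$. - $b(w)$ is the size (number of phrases) of the smallest bidirectional macro-scheme for $w$: a factorization of $w$ into non-empty phrases where each phrase of length greater than 1 has a copy in $w$ starting at a different position, in such a way that $w$ can be recovered by following these pointers (phrases of length 1 may be stored explicitly). - $v(w)$ is the number of phrases of the lex-parse: $w$ is parsed left to right, the phrase starting at position $i$ having length equal to the longest common prefix of the suffix $w[i:n]$ and the suffix of $w$ immediately preceding it in lexicographic order, or being a single explicit symbol if that length is 0 or there is no preceding suffix. - A straight-line program (SLP) is a deterministic context-free grammar whose language is a single string; its size is the sum of the lengths of its right-hand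 sides. $g(w)$ is the size of the smallest SLP generating $w$. A run-length SLP (RLSLP) also allows constant-size rules $A\to a^m$, $m>1$ ($a$ a grammar symbol). $g_{rl}(w)$ is the size of the smallest RLSLP generating $w$. - $c(w)$ is the size of the smallest collage system generating $w$: an RLSLP which additionally allows constant-size truncation rules $A\to B^{[t]}$ and $A\to {}^{[t]}B$ (the prefix, respectively suffix, of length $t$ of the expansion of $B$). - $z(w)$, $z_{no}(w)$, $z_e(w)$ are the numbers of phrases of the following greedy left-to-right parsings $w=w_1w_2\cdots w_k$, in which each phrase is the longest non-empty prefix of the remaining suffix satisfying a condition, or a single symbol if there is none. Lempel-Ziv ($z$): the phrase has a copy starting inside some previous phrase. LZ-no ($z_{no}$): the phrase has a copy fully contained in the concatenation of the previous phrases. LZ-End ($z_e$): the phrase has an occurrence in the concatenation of the previous phrases that ends at the end of a previous phrase. - $r(w)$ is the number of maximal runs of equal symbols in the Burrows-Wheeler transform of $w$, i.e. in the concatenation of the last symbols of the lexicographically sorted rotations of $w$. *)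

theory Defs
  imports
    Complex_Main
    "HOL-Library.Landau_Symbols"
    "HOL-Library.Sublist"
    "HOL-Library.List_Lexorder"
begin

text \<open>
  Symbols are natural numbers with their usual order; every finite ordered alphabet embeds.
  Strings are compared by the order of \<^theory>\<open>HOL-Library.List_Lexorder\<close>, in which a proper
  prefix is smaller. Positions in strings start at 1. All size measures are meant for non-empty
  strings; on \<^typ>\<open>nat\<close>, the infimum of a non-empty set is its minimum.
\<close>

type_synonym str = "nat list"

definition substr :: "str \<Rightarrow> nat \<Rightarrow> nat \<Rightarrow> str" where
  "substr w i j = take (Suc j - i) (drop (i - 1) w)"


section \<open>String families and asymptotics\<close>

definition string_family :: "str set \<Rightarrow> bool" where
  "string_family W \<longleftrightarrow> infinite W \<and> (\<forall>N. \<exists>w\<in>W. N \<le> length w)"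

text \<open>The filter "\<open>w \<in> W\<close> and \<open>length w\<close> tends to infinity", to be used in Landau symbols.\<close>

definition along :: "str set \<Rightarrow> str filter" where
  "along W = inf (filtercomap length at_top) (principal W)"


section \<open>L-systems\<close>

record lsystem =
  ls_alph :: "nat set"
  ls_rule :: "nat \<Rightarrow> str"
  ls_coding :: "nat \<Rightarrow> nat"
  ls_axiom :: str
  ls_levels :: nat
  ls_length :: nat

definition morph :: "(nat \<Rightarrow> str) \<Rightarrow> str \<Rightarrow> str" where
  "morph \<phi> u = concat (map \<phi> u)"

text \<open>
  The standing assumption that the number of levels and the alphabet size are polynomial in \<open>n\<close>
  is rendered by the bound \<open>n\<^sup>C\<close> for a fixed exponent \<open>C\<close>. The word \<open>\<phi>\<^sup>d(s)\<close> must have length at least \<open>n\<close>.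
\<close>

definition lsystem :: "nat \<Rightarrow> lsystem \<Rightarrow> bool" where
  "lsystem C L \<longleftrightarrow>
     finite (ls_alph L) \<and>
     (\<forall>a\<in>ls_alph L. ls_rule L a \<noteq> [] \<and> set (ls_rule L a) \<subseteq> ls_alph L \<and>
        ls_coding L a \<in> ls_alph L) \<and>
     ls_axiom L \<noteq> [] \<and> set (ls_axiom L) \<subseteq> ls_alph L \<and>
     ls_length L \<ge> 1 \<and>
     ls_length L \<le> length ((morph (ls_rule L) ^^ ls_levels L) (ls_axiom L)) \<and>
     ls_levels L \<le> ls_length L ^ C \<and> card (ls_alph L) \<le> ls_length L ^ C"

definition ls_string :: "lsystem \<Rightarrow> str" where
  "ls_string L =
     take (ls_length L)
       (map (ls_coding L) ((morph (ls_rule L) ^^ ls_levels L) (ls_axiom L)))"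

definition ls_size :: "lsystem \<Rightarrow> nat" where
  "ls_size L =
     (\<Sum>a\<in>ls_alph L. length (ls_rule L a)) + length (ls_axiom L) + card (ls_alph L) + 2"

definition ell :: "nat \<Rightarrow> str \<Rightarrow> nat" where
  "ell C w = Inf {ls_size L | L. lsystem C L \<and> ls_string L = w}"


section \<open>NU-systems\<close>

text \<open>\<open>Ext a k i j\<close> is the extraction symbol \<open>a(k)[i:j]\<close>.\<close>

datatype nusym = Sym nat | Ext nat nat nat nat

record nusystem =
  nu_alph :: "nat set"
  nu_rule :: "nat \<Rightarrow> nusym list"
  nu_coding :: "nat \<Rightarrow> nat"
  nu_axiom :: "nusym list"
  nu_levels :: nat
  nu_length :: nat

text \<open>Length of the string denoted by a symbol, as opposed to its contribution to the size.\<close>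

fun nu_width :: "nusym \<Rightarrow> nat" where
  "nu_width (Sym a) = 1"
| "nu_width (Ext a k i j) = Suc j - i"

abbreviation nu_widths :: "nusym list \<Rightarrow> nat" where
  "nu_widths us \<equiv> sum_list (map nu_width us)"

fun nu_sym_size :: "nusym \<Rightarrow> nat" where
  "nu_sym_size (Sym a) = 1"
| "nu_sym_size (Ext a k i j) = 4"

abbreviation nu_syms_size :: "nusym list \<Rightarrow> nat" where
  "nu_syms_size us \<equiv> sum_list (map nu_sym_size us)"

text \<open>
  \<open>nu_at N us k p c\<close>: the symbol at position \<open>p\<close> of the \<open>k\<close>-th level generated from \<open>us\<close> is \<open>c\<close>.
  At level 0 the extraction symbols of \<open>us\<close> are replaced by what they denote, with the coding
  applied. To locate position \<open>p\<close> at level \<open>k + 1\<close> one needs the prefix \<open>bs @ [b]\<close> of level \<open>k\<close>,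
  where \<open>b\<close> is the symbol whose image covers that position. Since the predicate is inductive, a
  position whose evaluation loops has no symbol.
\<close>

inductive nu_at :: "nusystem \<Rightarrow> nusym list \<Rightarrow> nat \<Rightarrow> nat \<Rightarrow> nat \<Rightarrow> bool" for N where
  sym: "nu_at N (us @ Sym a # vs) 0 (nu_widths us + 1) a"
| ext: "q < nu_width (Ext b k i j) \<Longrightarrow> nu_at N [Sym b] k (i + q) a \<Longrightarrow>
        nu_at N (us @ Ext b k i j # vs) 0 (nu_widths us + 1 + q) (nu_coding N a)"
| level: "(\<forall>m<length bs. nu_at N us k (m + 1) (bs ! m)) \<Longrightarrow>
          nu_at N us k (length bs + 1) b \<Longrightarrow>
          nu_at N (nu_rule N b) 0 p c \<Longrightarrow>
          nu_at N us (Suc k) (nu_widths (concat (map (nu_rule N) bs)) + p) c"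

text \<open>Every prefix that has to be generated in order to extract from it must be free of loops.\<close>

definition nu_sym_ok :: "nusystem \<Rightarrow> nusym \<Rightarrow> bool" where
  "nu_sym_ok N u \<longleftrightarrow>
     (case u of
        Sym a \<Rightarrow> a \<in> nu_alph N
      | Ext a k i j \<Rightarrow> a \<in> nu_alph N \<and> k \<le> nu_length N \<and> 1 \<le> i \<and> i \<le> j \<and> j \<le> nu_length N \<and>
          (\<forall>p\<in>{1..j}. \<exists>c. nu_at N [Sym a] k p c))"

definition nusystem :: "nat \<Rightarrow> nusystem \<Rightarrow> bool" where
  "nusystem C N \<longleftrightarrow>
     finite (nu_alph N) \<and>
     (\<forall>a\<in>nu_alph N. nu_rule N a \<noteq> [] \<and> (\<forall>u\<in>set (nu_rule N a). nu_sym_ok N u) \<and>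
        nu_coding N a \<in> nu_alph N) \<and>
     nu_axiom N \<noteq> [] \<and> (\<forall>u\<in>set (nu_axiom N). nu_sym_ok N u) \<and>
     nu_length N \<ge> 1 \<and>
     nu_levels N \<le> nu_length N ^ C \<and> card (nu_alph N) \<le> nu_length N ^ C"

definition nu_generates :: "nusystem \<Rightarrow> str \<Rightarrow> bool" where
  "nu_generates N w \<longleftrightarrow> length w = nu_length N \<and>
     (\<forall>p\<in>{1..length w}. \<exists>c. nu_at N (nu_axiom N) (nu_levels N) p c \<and> w ! (p - 1) = nu_coding N c)"

definition nu_size :: "nusystem \<Rightarrow> nat" where
  "nu_size N =
     (\<Sum>a\<in>nu_alph N. nu_syms_size (nu_rule N a)) + nu_syms_size (nu_axiom N) +
     card (nu_alph N) + 2"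

definition nu :: "nat \<Rightarrow> str \<Rightarrow> nat" where
  "nu C w = Inf {nu_size N | N. nusystem C N \<and> nu_generates N w}"


section \<open>Substring complexity and string attractors\<close>

definition delta :: "str \<Rightarrow> real" where
  "delta w = Max ((\<lambda>k. real (card {u. sublist u w \<and> length u = k}) / real k) ` {1..length w})"

definition string_attractor :: "str \<Rightarrow> nat set \<Rightarrow> bool" where
  "string_attractor w \<Gamma> \<longleftrightarrow> \<Gamma> \<subseteq> {1..length w} \<and>
     (\<forall>u. sublist u w \<and> u \<noteq> [] \<longrightarrow>
        (\<exists>i j p. 1 \<le> i \<and> j \<le> length w \<and> substr w i j = u \<and> p \<in> \<Gamma> \<and> i \<le> p \<and> p \<le> j))"

definition gamma :: "str \<Rightarrow> nat" where
  "gamma w = Inf {card \<Gamma> | \<Gamma>. string_attractor w \<Gamma>}"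


section \<open>Bidirectional macro-schemes\<close>

text \<open>
  A phrase is given by its length and the starting position of its source (\<open>None\<close> for an
  explicitly stored symbol).
\<close>

type_synonym macro_scheme = "(nat \<times> nat option) list"

definition phrase_start :: "macro_scheme \<Rightarrow> nat \<Rightarrow> nat" where
  "phrase_start B t = 1 + sum_list (map fst (take t B))"

inductive recoverable :: "macro_scheme \<Rightarrow> nat \<Rightarrow> bool" for B where
  explicit: "t < length B \<Longrightarrow> B ! t = (1, None) \<Longrightarrow> recoverable B (phrase_start B t)"
| copied: "t < length B \<Longrightarrow> B ! t = (l, Some q) \<Longrightarrow> m < l \<Longrightarrow> recoverable B (q + m) \<Longrightarrow>
           recoverable B (phrase_start B t + m)"

definition macro_scheme :: "str \<Rightarrow> macro_scheme \<Rightarrow> bool" where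
  "macro_scheme w B \<longleftrightarrow>
     sum_list (map fst B) = length w \<and>
     (\<forall>t<length B. case B ! t of
        (l, None) \<Rightarrow> l = 1
      | (l, Some q) \<Rightarrow> l \<ge> 1 \<and> q \<ge> 1 \<and> q + l - 1 \<le> length w \<and> q \<noteq> phrase_start B t \<and>
          substr w q (q + l - 1) = substr w (phrase_start B t) (phrase_start B t + l - 1)) \<and>
     (\<forall>p\<in>{1..length w}. recoverable B p)"

definition bms :: "str \<Rightarrow> nat" where
  "bms w = Inf {length B | B. macro_scheme w B}"


section \<open>Left-to-right parsings\<close>

text \<open>
  \<open>parse f ps x\<close> continues the parsing \<open>ps\<close> with the remaining suffix \<open>x\<close> of
  \<open>concat ps @ x\<close>. The next phrase has length \<open>f ps x\<close>, or 1 if that is 0.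
\<close>

function parse :: "(str list \<Rightarrow> str \<Rightarrow> nat) \<Rightarrow> str list \<Rightarrow> str \<Rightarrow> str list" where
  "parse f ps x =
     (if x = [] then ps
      else let l = max 1 (f ps x) in parse f (ps @ [take l x]) (drop l x))"
  by pat_completeness auto
termination
  by (relation "measure (\<lambda>(f, ps, x). length x)") auto

declare parse.simps [simp del]

definition greedy :: "(str list \<Rightarrow> str \<Rightarrow> str \<Rightarrow> bool) \<Rightarrow> str list \<Rightarrow> str \<Rightarrow> nat" where
  "greedy P ps x = Max (insert 0 {l \<in> {1..length x}. P ps x (take l x)})"

text \<open>The source of an LZ phrase may overlap the phrase itself.\<close>

definition lz_source :: "str list \<Rightarrow> str \<Rightarrow> str \<Rightarrow> bool" where
  "lz_source ps x u \<longleftrightarrow>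
     (\<exists>q\<in>{1..length (concat ps)}. prefix u (drop (q - 1) (concat ps @ x)))"

definition lz_no_source :: "str list \<Rightarrow> str \<Rightarrow> str \<Rightarrow> bool" where
  "lz_no_source ps x u \<longleftrightarrow> sublist u (concat ps)"

definition lz_end_source :: "str list \<Rightarrow> str \<Rightarrow> str \<Rightarrow> bool" where
  "lz_end_source ps x u \<longleftrightarrow> (\<exists>t\<in>{1..length ps}. suffix u (concat (take t ps)))"

definition lz_z :: "str \<Rightarrow> nat" where
  "lz_z w = length (parse (greedy lz_source) [] w)"

definition lz_no_z :: "str \<Rightarrow> nat" where
  "lz_no_z w = length (parse (greedy lz_no_source) [] w)"

definition lz_end_z :: "str \<Rightarrow> nat" where
  "lz_end_z w = length (parse (greedy lz_end_source) [] w)"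

definition lex_smaller_suffixes :: "str \<Rightarrow> str \<Rightarrow> str set" where
  "lex_smaller_suffixes w x = {y. suffix y w \<and> y \<noteq> [] \<and> y < x}"

definition lex_length :: "str list \<Rightarrow> str \<Rightarrow> nat" where
  "lex_length ps x =
     (let Y = lex_smaller_suffixes (concat ps @ x) x in
      if Y = {} then 0 else length (longest_common_prefix x (Max Y)))"

definition lex_v :: "str \<Rightarrow> nat" where
  "lex_v w = length (parse lex_length [] w)"


section \<open>Grammars and collage systems\<close>

datatype gsym = Term nat | Var nat

datatype rhs = Seq "gsym list" | Run gsym nat | Pre nat nat | Suf nat nat

record grammar =
  gr_vars :: "nat set"
  gr_rule :: "nat \<Rightarrow> rhs"
  gr_start :: nat

text \<open>
  The rules are a function of the variable, so a symbol derives at most one string. A symbol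
  whose derivation loops derives none.
\<close>

inductive derives :: "grammar \<Rightarrow> gsym \<Rightarrow> str \<Rightarrow> bool" for G where
  terminal: "derives G (Term a) [a]"
| seq: "A \<in> gr_vars G \<Longrightarrow> gr_rule G A = Seq Xs \<Longrightarrow> list_all2 (derives G) Xs us \<Longrightarrow>
        derives G (Var A) (concat us)"
| run: "A \<in> gr_vars G \<Longrightarrow> gr_rule G A = Run X m \<Longrightarrow> derives G X u \<Longrightarrow>
        derives G (Var A) (concat (replicate m u))"
| prefix_rule: "A \<in> gr_vars G \<Longrightarrow> gr_rule G A = Pre B t \<Longrightarrow> derives G (Var B) u \<Longrightarrow> t \<le> length u \<Longrightarrow>
        derives G (Var A) (take t u)"
| suffix_rule: "A \<in> gr_vars G \<Longrightarrow> gr_rule G A = Suf B t \<Longrightarrow> derives G (Var B) u \<Longrightarrow> t \<le> length u \<Longrightarrow>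
        derives G (Var A) (drop (length u - t) u)"

fun rhs_size :: "rhs \<Rightarrow> nat" where
  "rhs_size (Seq Xs) = length Xs"
| "rhs_size (Run X m) = 2"
| "rhs_size (Pre B t) = 2"
| "rhs_size (Suf B t) = 2"

fun gsym_ok :: "grammar \<Rightarrow> gsym \<Rightarrow> bool" where
  "gsym_ok G (Term a) \<longleftrightarrow> True"
| "gsym_ok G (Var A) \<longleftrightarrow> A \<in> gr_vars G"

fun rhs_ok :: "grammar \<Rightarrow> rhs \<Rightarrow> bool" where
  "rhs_ok G (Seq Xs) \<longleftrightarrow> Xs \<noteq> [] \<and> (\<forall>X\<in>set Xs. gsym_ok G X)"
| "rhs_ok G (Run X m) \<longleftrightarrow> m > 1 \<and> gsym_ok G X"
| "rhs_ok G (Pre B t) \<longleftrightarrow> t \<ge> 1 \<and> B \<in> gr_vars G"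
| "rhs_ok G (Suf B t) \<longleftrightarrow> t \<ge> 1 \<and> B \<in> gr_vars G"

definition collage_system :: "grammar \<Rightarrow> bool" where
  "collage_system G \<longleftrightarrow> finite (gr_vars G) \<and> gr_start G \<in> gr_vars G \<and>
     (\<forall>A\<in>gr_vars G. rhs_ok G (gr_rule G A))"

definition rlslp :: "grammar \<Rightarrow> bool" where
  "rlslp G \<longleftrightarrow> collage_system G \<and>
     (\<forall>A\<in>gr_vars G. (\<exists>Xs. gr_rule G A = Seq Xs) \<or> (\<exists>X m. gr_rule G A = Run X m))"

definition slp :: "grammar \<Rightarrow> bool" where
  "slp G \<longleftrightarrow> collage_system G \<and> (\<forall>A\<in>gr_vars G. \<exists>Xs. gr_rule G A = Seq Xs)"

definition gr_size :: "grammar \<Rightarrow> nat" where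
  "gr_size G = (\<Sum>A\<in>gr_vars G. rhs_size (gr_rule G A))"

definition gr_generates :: "grammar \<Rightarrow> str \<Rightarrow> bool" where
  "gr_generates G w \<longleftrightarrow> derives G (Var (gr_start G)) w"

definition slp_g :: "str \<Rightarrow> nat" where
  "slp_g w = Inf {gr_size G | G. slp G \<and> gr_generates G w}"

definition rlslp_g :: "str \<Rightarrow> nat" where
  "rlslp_g w = Inf {gr_size G | G. rlslp G \<and> gr_generates G w}"

definition collage_c :: "str \<Rightarrow> nat" where
  "collage_c w = Inf {gr_size G | G. collage_system G \<and> gr_generates G w}"


section \<open>Runs of the Burrows-Wheeler transform\<close>

definition bwt :: "str \<Rightarrow> str" where
  "bwt w = map last (sort (map (\<lambda>i. rotate i w) [0..<length w]))"

definition bwt_r :: "str \<Rightarrow> nat" where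
  "bwt_r w = length (remdups_adj (bwt w))"

end

theory Submission
  imports Defs "HOL-Library.Multiset"
begin

text \<open>
  All ten measures dominate \<open>\<delta>\<close> up to a factor 2, and \<open>\<delta>\<close> is unbounded on the strings
  \<open>2 1 10 100 1000 \<dots>\<close>, which are iterates of the fixed morphism \<open>2 \<rightarrow> 21\<close>, \<open>1 \<rightarrow> 10\<close>, \<open>0 \<rightarrow> 0\<close>. This is
  one family with \<open>\<ell> = o(\<mu>)\<close> for all \<open>\<mu>\<close>.

  Conversely, on a string of \<open>K + 1\<close> blocks \<open>0\<^sup>e 1\<close>, where the first run has length \<open>2 ^ (K + 1)\<close> and the
  others have a length in \<open>{2 ^ K..<2 ^ (K + 1)}\<close>, all ten measures are \<open>O(K)\<close>. There are \<open>2 ^ (K * K)\<close>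
  such strings, and only \<open>2 ^ O(s log s + C K)\<close> L-systems of size \<open>s\<close> with at most \<open>n ^ C\<close> levels, so
  for \<open>K = q\<^sup>2\<close> and \<open>C = q\<close> some string has \<open>\<ell>\<close> larger than \<open>q\<^sup>3\<close>. Since the exponent grows along the
  family, the bound holds for each fixed \<open>C\<close> in the limit.
\<close>

text \<open>The theorem asks for one family that defeats every exponent \<open>C\<close>, while
  counting needs a bound on the number of levels and so treats one exponent at a time. As
  \<open>ell C w\<close> is antitone in \<open>C\<close>, it suffices to let the exponent grow with
  the word. The parameters K = q^2 and exponent q balance as follows. A hard word carries K bits in
  each of K runs, q^4 in all. The number of levels costs about 3 K q = 3 q^3 bits and a system of
  size q^3 costs O(q^3 log q) bits, which together is less; yet q^3 still exceeds K by the factor q.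
  Runs carry the information because a run costs each measure O(1) whatever its length. The parsings
  whose sources must not overlap the phrase need care: they build a run by doubling, and an LZ-End
  source must moreover end at a phrase end. Hence one first run, at least as long as all others, is
  paid for with O(K) phrases and then serves as the source of every later run. The factor 2 in the
  comparison with \<delta> comes from grammars alone, where single-symbol factors are counted
  separately.\<close>

section \<open>Families indexed by natural numbers\<close>

text \<open>Only the finitely many words with index below \<open>Q\<close> can fail, and a length
  larger than the sum of their lengths excludes them. So \<open>f\<close> may be neither injective
  nor monotone in length.\<close>

lemma eventually_along_range:
  fixes f :: "nat \<Rightarrow> str"
  assumes "\<And>q. Q \<le> q \<Longrightarrow> P (f q)"
  shows "eventually P (along (range f))"
proof -
  define M where "M = Suc (\<Sum>q<Q. length (f q))"
  have "P w" if w: "w \<in> range f" "M \<le> length w" for w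
  proof -
    obtain q where q: "w = f q" using w by auto
    have "\<not> q < Q"
    proof
      assume "q < Q"
      then have "length (f q) \<le> (\<Sum>q<Q. length (f q))"
        by (intro member_le_sum[of q "{..<Q}" "\<lambda>q. length (f q)"]) (auto simp: \<open>q < Q\<close>)
      with w q show False by (simp add: M_def)
    qed
    with assms q show ?thesis by simp
  qed
  then show ?thesis
    unfolding along_def eventually_inf_principal eventually_filtercomap_at_top_linorder by blast
qed

lemma string_family_range:
  fixes f :: "nat \<Rightarrow> str"
  assumes "\<And>q. q \<le> length (f q)"
  shows "string_family (range f)"
proof -
  have "\<not> finite (range f)"
  proof
    assume fin: "finite (range f)"
    then have "length (f (Suc (sum length (range f)))) \<le> sum length (range f)"
      by (intro member_le_sum) auto
    with assms[of "Suc (sum length (range f))"] show False by simp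
  qed
  then show ?thesis using assms unfolding string_family_def by blast
qed

lemma Inf_nat_lower: "(x::nat) \<in> A \<Longrightarrow> Inf A \<le> x"
  by (simp add: cInf_lower)

lemma eventually_along_nonempty:
  "eventually (\<lambda>w. w \<noteq> []) (along W)"
  unfolding along_def eventually_inf_principal eventually_filtercomap_at_top_linorder
  by (intro exI[of _ 1]) auto

section \<open>Domination of \<delta> by the other measures\<close>

section \<open>Substring complexity\<close>

lemma sublist_iff_take_drop:
  "sublist u w \<longleftrightarrow> (\<exists>i. i + length u \<le> length w \<and> u = take (length u) (drop i w))"
proof
  assume "sublist u w"
  then obtain a b where "w = a @ u @ b" by (auto simp: sublist_def)
  then show "\<exists>i. i + length u \<le> length w \<and> u = take (length u) (drop i w)"
    by (intro exI[of _ "length a"]) simp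
next
  assume "\<exists>i. i + length u \<le> length w \<and> u = take (length u) (drop i w)"
  then show "sublist u w"
    by (metis append_take_drop_id sublist_appendI)
qed

lemma sublist_take_drop: "sublist (take l (drop i w)) w"
  by (meson set_mono_sublist sublist_drop sublist_order.order_trans sublist_take)

definition factors :: "nat \<Rightarrow> str \<Rightarrow> str set" where
  "factors k w = {u. sublist u w \<and> length u = k}"

lemma finite_factors: "finite (factors k w)"
  by (rule finite_subset[of _ "{u. set u \<subseteq> set w \<and> length u = k}"])
     (auto simp: factors_def dest: set_mono_sublist intro: finite_lists_length_eq)

lemma delta_le:
  assumes "w \<noteq> []" and "\<And>k. 1 \<le> k \<Longrightarrow> k \<le> length w \<Longrightarrow> real (card (factors k w)) \<le> x * real k"
  shows "delta w \<le> x"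
  unfolding delta_def factors_def[symmetric]
proof (rule Max.boundedI)
  show "(\<lambda>k. real (card (factors k w)) / real k) ` {1..length w} \<noteq> {}"
    using assms(1) by (cases w) auto
qed (use assms(2) in \<open>auto simp: divide_simps\<close>)

lemma delta_ge:
  assumes "1 \<le> k" "k \<le> length w"
  shows "real (card (factors k w)) / real k \<le> delta w"
  unfolding delta_def factors_def[symmetric] using assms by (intro Max_ge) auto

lemma delta_nonneg: "w \<noteq> [] \<Longrightarrow> 0 \<le> delta w"
  using delta_ge[of 1 w] by (cases w) (auto intro: order_trans[rotated])

section \<open>String attractors\<close>

lemma string_attractor_full: "string_attractor w {1..length w}"
  unfolding string_attractor_def
proof (intro conjI allI impI)
  fix u assume u: "sublist u w \<and> u \<noteq> []"
  then obtain i where i: "i + length u \<le> length w" "u = take (length u) (drop i w)"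
    using sublist_iff_take_drop by blast
  have "Suc 0 \<le> length u" using u by (cases u) auto
  then show "\<exists>i j p. 1 \<le> i \<and> j \<le> length w \<and> substr w i j = u \<and> p \<in> {1..length w} \<and> i \<le> p \<and> p \<le> j"
    using i by (intro exI[of "\<lambda>i. \<exists>j p. _ i j p" "Suc i"] exI[of "\<lambda>j. \<exists>p. _ j p" "i + length u"] exI[of _ "Suc i"] conjI)
      (auto simp: substr_def)
qed simp

lemma gamma_attained:
  obtains \<Gamma> where "string_attractor w \<Gamma>" "gamma w = card \<Gamma>"
proof -
  have "gamma w \<in> {card \<Gamma> | \<Gamma>. string_attractor w \<Gamma>}"
    unfolding gamma_def using string_attractor_full by (intro Inf_nat_def1) blast
  with that show ?thesis by blast
qed

lemma gamma_le: "string_attractor w \<Gamma> \<Longrightarrow> gamma w \<le> card \<Gamma>"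
  unfolding gamma_def by (rule Inf_nat_lower) blast

text \<open>Each factor has an occurrence through a marked position, and the position together with
  its offset inside the occurrence determines the factor.\<close>

lemma card_factors_le_attractor:
  assumes att: "string_attractor w \<Gamma>" and k: "1 \<le> k"
  shows "card (factors k w) \<le> card \<Gamma> * k"
proof -
  have fin: "finite \<Gamma>" using att finite_subset by (auto simp: string_attractor_def)
  let ?F = "(\<lambda>(p,q). take k (drop (p - 1 - q) w))"
  have "factors k w \<subseteq> ?F ` (\<Gamma> \<times> {..<k})"
  proof
    fix u assume u: "u \<in> factors k w"
    then have "sublist u w" "u \<noteq> []" "length u = k" using k by (auto simp: factors_def)
    then obtain i j p where *: "1 \<le> i" "j \<le> length w" "substr w i j = u" "p \<in> \<Gamma>" "i \<le> p" "p \<le> j"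
      using att unfolding string_attractor_def by blast
    have len: "Suc j - i = k" using * \<open>length u = k\<close> by (auto simp: substr_def)
    have "u = ?F (p, p - i)" using * len by (simp add: substr_def)
    moreover have "p - i < k" using * len by linarith
    ultimately show "u \<in> ?F ` (\<Gamma> \<times> {..<k})" using * by (intro image_eqI) auto
  qed
  then have "card (factors k w) \<le> card (?F ` (\<Gamma> \<times> {..<k}))"
    using fin by (intro card_mono) auto
  also have "\<dots> \<le> card (\<Gamma> \<times> {..<k})" using fin by (intro card_image_le) auto
  finally show ?thesis by (simp add: card_cartesian_product)
qed

lemma delta_le_gamma:
  assumes "w \<noteq> []"
  shows "delta w \<le> real (gamma w)"
proof -
  obtain \<Gamma> where \<Gamma>: "string_attractor w \<Gamma>" "gamma w = card \<Gamma>" by (rule gamma_attained)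
  show ?thesis
  proof (rule delta_le[OF assms])
    fix k :: nat assume "1 \<le> k"
    then show "real (card (factors k w)) \<le> real (gamma w) * real k"
      using card_factors_le_attractor[OF \<Gamma>(1)] \<Gamma>(2) by (metis of_nat_le_iff of_nat_mult)
  qed
qed

text \<open>
  Every scheme that copies the unmarked factors from a source that is smaller in some well-founded
  order yields an attractor: following the sources must end at an occurrence that contains a marked
  position. Here \<open>i\<close> counts the symbols before an occurrence.
\<close>

lemma string_attractor_descent:
  assumes "\<Gamma> \<subseteq> {1..length w}" and "wf R"
    and descent: "\<And>i l. 1 \<le> l \<Longrightarrow> i + l \<le> length w \<Longrightarrow>
      (\<exists>p\<in>\<Gamma>. i < p \<and> p \<le> i + l) \<or>
      (\<exists>i'. (i', i) \<in> R \<and> i' + l \<le> length w \<and> take l (drop i' w) = take l (drop i w))"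
  shows "string_attractor w \<Gamma>"
  unfolding string_attractor_def
proof (intro conjI allI impI)
  fix u assume u: "sublist u w \<and> u \<noteq> []"
  then obtain i where i: "i + length u \<le> length w" "u = take (length u) (drop i w)"
    using sublist_iff_take_drop by blast
  have l: "1 \<le> length u" using u by (cases u) auto
  from i show "\<exists>i j p. 1 \<le> i \<and> j \<le> length w \<and> substr w i j = u \<and> p \<in> \<Gamma> \<and> i \<le> p \<and> p \<le> j"
  proof (induction i rule: wf_induct_rule[OF \<open>wf R\<close>])
    case (1 i)
    from descent[OF l 1(2)] consider
      p where "p \<in> \<Gamma>" "i < p" "p \<le> i + length u"
      | i' where "(i', i) \<in> R" "i' + length u \<le> length w"
          "take (length u) (drop i' w) = take (length u) (drop i w)"
      by blast
    then show ?case
    proof cases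
      case 1
      with \<open>i + length u \<le> length w\<close> \<open>u = take (length u) (drop i w)\<close> show ?thesis
        by (intro exI[of _ "Suc i"] exI[of _ "i + length u"] exI[of _ p]) (auto simp: substr_def)
    next
      case 2
      with 1 show ?thesis by metis
    qed
  qed
qed (rule assms(1))

section \<open>Macro-schemes\<close>

lemma macro_scheme_explicit: "macro_scheme w (replicate (length w) (1, None))"
proof -
  let ?B = "replicate (length w) (1::nat, None :: nat option)"
  have start: "phrase_start ?B t = Suc t" if "t < length w" for t
    using that by (simp add: phrase_start_def sum_list_replicate)
  have "recoverable ?B p" if p: "p \<in> {1..length w}" for p
    using recoverable.explicit[of "p - 1" ?B] p start[of "p - 1"] by force
  then show ?thesis
    by (auto simp: macro_scheme_def sum_list_replicate)
qed

lemma bms_attained: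
  obtains B where "macro_scheme w B" "bms w = length B"
proof -
  have "bms w \<in> {length B | B. macro_scheme w B}"
    unfolding bms_def using macro_scheme_explicit by (intro Inf_nat_def1) blast
  with that show ?thesis by blast
qed

lemma bms_le: "macro_scheme w B \<Longrightarrow> bms w \<le> length B"
  unfolding bms_def by (rule Inf_nat_lower) blast

lemma phrase_start_Suc:
  "t < length B \<Longrightarrow> phrase_start B (Suc t) = phrase_start B t + fst (B ! t)"
  by (simp add: phrase_start_def take_Suc_conv_app_nth)

lemma phrase_start_le:
  assumes "t \<le> length B" shows "phrase_start B t \<le> Suc (sum_list (map fst B))"
proof -
  have "sum_list (map fst B) = sum_list (map fst (take t B)) + sum_list (map fst (drop t B))"
    by (metis append_take_drop_id map_append sum_list_append)
  then show ?thesis by (simp add: phrase_start_def)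
qed

text \<open>The phrase starts form an attractor. Following the copy pointer of the first symbol of
  an occurrence moves the whole occurrence, as long as it lies inside one phrase. The recovery of
  that symbol ends, so sooner or later the occurrence contains a phrase start.\<close>

lemma gamma_le_bms: "gamma w \<le> bms w"
proof -
  obtain B where B: "macro_scheme w B" "bms w = length B" by (rule bms_attained)
  let ?n = "length w"
  define \<Gamma> where "\<Gamma> = phrase_start B ` {..<length B}"
  have sum: "sum_list (map fst B) = ?n" and rec: "\<And>p. p \<in> {1..?n} \<Longrightarrow> recoverable B p"
    using B by (auto simp: macro_scheme_def)
  have ph: "case B ! t of (l, None) \<Rightarrow> l = 1
      | (l, Some q) \<Rightarrow> l \<ge> 1 \<and> q \<ge> 1 \<and> q + l - 1 \<le> length w \<and> q \<noteq> phrase_start B t \<and>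
          substr w q (q + l - 1) = substr w (phrase_start B t) (phrase_start B t + l - 1)"
    if "t < length B" for t
    using B(1)[unfolded macro_scheme_def, THEN conjunct2, THEN conjunct1, rule_format, OF that] .
  have len1: "1 \<le> fst (B ! t)" if "t < length B" for t
    using ph[OF that] by (auto split: prod.splits option.splits)
  have bound: "phrase_start B t + fst (B ! t) \<le> Suc ?n" if "t < length B" for t
    using phrase_start_le[of "Suc t" B] phrase_start_Suc[OF that] that sum by simp
  have sub: "\<Gamma> \<subseteq> {1..?n}"
  proof
    fix p assume "p \<in> \<Gamma>"
    then obtain t where "t < length B" "p = phrase_start B t" by (auto simp: \<Gamma>_def)
    then show "p \<in> {1..?n}" using bound[of t] len1[of t] by (auto simp: phrase_start_def)
  qed
  \<comment> \<open>The induction follows the recovery of the first position \<open>i\<close>.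
    Positions count from 1, so the occurrence ends at \<open>i + l - 1\<close>.\<close>
  have key: "\<exists>i' p. 1 \<le> i' \<and> i' + l \<le> Suc ?n \<and> take l (drop (i' - 1) w) = take l (drop (i - 1) w) \<and>
      p \<in> \<Gamma> \<and> i' \<le> p \<and> p < i' + l"
    if "recoverable B i" "1 \<le> l" "i + l \<le> Suc ?n" for i l
    using that
  proof (induction arbitrary: l rule: recoverable.induct)
    case (explicit t)
    then show ?case
      by (intro exI[of _ "phrase_start B t"]) (auto simp: \<Gamma>_def phrase_start_def)
  next
    case (copied t L q m)
    let ?s = "phrase_start B t"
    have s1: "1 \<le> ?s" by (simp add: phrase_start_def)
    have src: "q \<ge> 1" "q + L - 1 \<le> ?n" "L \<ge> 1"
        "substr w q (q + L - 1) = substr w ?s (?s + L - 1)"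
      using ph[OF copied(1)] copied(2) by auto
    show ?case
    proof (cases "m = 0 \<or> m + l > L")
      case True
      then show ?thesis
      proof
        assume "m = 0"
        then show ?thesis using copied s1
          by (intro exI[of _ ?s]) (auto simp: \<Gamma>_def)
      next
        assume big: "m + l > L"
        have nxt: "phrase_start B (Suc t) = ?s + L"
          using phrase_start_Suc[OF copied(1)] copied(2) by simp
        \<comment> \<open>The last phrase ends with the word, so an occurrence that sticks out of
          phrase \<open>t\<close> has a next phrase to enter, and it contains the start of that
          phrase.\<close>
        have "Suc t < length B"
        proof (rule ccontr)
          assume "\<not> Suc t < length B"
          then have "Suc t = length B" using copied(1) by simp
          then have "phrase_start B (Suc t) = Suc ?n" using sum by (simp add: phrase_start_def)
          then show False using nxt big copied by simp
        qed
        then have "?s + L \<in> \<Gamma>" using nxt unfolding \<Gamma>_def by (metis imageI lessThan_iff)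
        then show ?thesis using copied big s1
          by (intro exI[of _ "?s + m"] exI[of _ "?s + L"]) auto
      qed
    next
      case False
      then have ml: "m + l \<le> L" by simp
      have a: "take L (drop (q - 1) w) = take L (drop (?s - 1) w)"
        using src s1 by (simp add: substr_def)
      have "take l (drop m (take L (drop (q - 1) w))) = take l (drop m (take L (drop (?s - 1) w)))"
        using a by simp
      then have "take l (drop (q + m - 1) w) = take l (drop (?s + m - 1) w)"
        using ml src s1 by (simp add: drop_take min_absorb1 add.commute)
      moreover have "q + m + l \<le> Suc ?n" using ml src by linarith
      ultimately show ?thesis using copied(5)[OF copied(6)] by metis
    qed
  qed
  have "string_attractor w \<Gamma>"
    unfolding string_attractor_def
  proof (intro conjI allI impI)
    fix u assume u: "sublist u w \<and> u \<noteq> []"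
    then obtain i where i: "i + length u \<le> length w" "u = take (length u) (drop i w)"
      using sublist_iff_take_drop by blast
    have l: "1 \<le> length u" using u by (cases u) auto
    have "recoverable B (Suc i)" using rec i(1) l by simp
    from key[OF this l] i obtain i' p where
      "1 \<le> i'" "i' + length u \<le> Suc ?n" "take (length u) (drop (i' - 1) w) = u"
      "p \<in> \<Gamma>" "i' \<le> p" "p < i' + length u" by auto
    then show "\<exists>i j p. 1 \<le> i \<and> j \<le> length w \<and> substr w i j = u \<and> p \<in> \<Gamma> \<and> i \<le> p \<and> p \<le> j"
      by (intro exI[of _ i'] exI[of _ "i' + length u - 1"] exI[of _ p]) (auto simp: substr_def)
  qed (rule sub)
  then have "gamma w \<le> card \<Gamma>" by (rule gamma_le)
  also have "\<dots> \<le> bms w" using card_image_le[of "{..<length B}" "phrase_start B"] B by (simp add: \<Gamma>_def)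
  finally show ?thesis .
qed

section \<open>Left-to-right parsings\<close>

lemma parse_Nil: "parse f ps [] = ps"
  by (simp add: parse.simps)

lemma parse_step:
  "x \<noteq> [] \<Longrightarrow> parse f ps x = parse f (ps @ [take (max 1 (f ps x)) x]) (drop (max 1 (f ps x)) x)"
  by (subst parse.simps) (simp add: Let_def)

text \<open>The set collects the starts of the phrases still to come. An occurrence that starts
  strictly inside a phrase either stays in it, where \<open>copy\<close> supplies an
  \<open>R\<close>-smaller source, or reaches the start of the next phrase. The relation is a
  parameter because LZ sources lie further left, while sources of the lex-parse only have a smaller
  suffix rank.\<close>

lemma attractor_of_parse:
  assumes copy: "\<And>ps x i l. concat ps @ x = w \<Longrightarrow> length (concat ps) < i \<Longrightarrow> 1 \<le> l \<Longrightarrow>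
      i + l \<le> length (concat ps) + f ps x \<Longrightarrow> i + l \<le> length w \<Longrightarrow>
      \<exists>i'. (i', i) \<in> R \<and> i' + l \<le> length w \<and> take l (drop i' w) = take l (drop i w)"
  assumes "concat ps @ x = w"
  shows "\<exists>\<Gamma>\<subseteq>{Suc (length (concat ps))..length w}.
      card \<Gamma> + length ps \<le> length (parse f ps x) \<and> (x \<noteq> [] \<longrightarrow> Suc (length (concat ps)) \<in> \<Gamma>) \<and>
      (\<forall>i l. length (concat ps) \<le> i \<and> 1 \<le> l \<and> i + l \<le> length w \<longrightarrow>
        (\<exists>p\<in>\<Gamma>. i < p \<and> p \<le> i + l) \<or>
        (\<exists>i'. (i', i) \<in> R \<and> i' + l \<le> length w \<and> take l (drop i' w) = take l (drop i w)))"
  using assms(2)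
proof (induction "length x" arbitrary: ps x rule: less_induct)
  case less
  show ?case
  proof (cases "x = []")
    case True
    then show ?thesis using less(2) by (intro exI[of _ "{}"]) (auto simp: parse_Nil)
  next
    case False
    let ?l = "max 1 (f ps x)" and ?s = "length (concat ps)"
    let ?ps = "ps @ [take ?l x]" and ?x = "drop ?l x"
    have w: "concat ?ps @ ?x = w" using less(2) by simp
    have shorter: "length ?x < length x" using False by (cases x) auto
    have s': "length (concat ?ps) = ?s + min ?l (length x)" by (simp add: min.commute)
    have n: "length w = ?s + length x" using less(2) by auto
    obtain \<Gamma> where \<Gamma>: "\<Gamma> \<subseteq> {Suc (length (concat ?ps))..length w}"
      "card \<Gamma> + length ?ps \<le> length (parse f ?ps ?x)"
      "?x \<noteq> [] \<Longrightarrow> Suc (length (concat ?ps)) \<in> \<Gamma>"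
      and cov: "\<And>i l. length (concat ?ps) \<le> i \<Longrightarrow> 1 \<le> l \<Longrightarrow> i + l \<le> length w \<Longrightarrow>
        (\<exists>p\<in>\<Gamma>. i < p \<and> p \<le> i + l) \<or>
        (\<exists>i'. (i', i) \<in> R \<and> i' + l \<le> length w \<and> take l (drop i' w) = take l (drop i w))"
      using less(1)[OF shorter w] by blast
    have xpos: "1 \<le> length x" using False by (cases x) auto
    have fin: "finite \<Gamma>" using \<Gamma>(1) finite_subset by blast
    let ?G = "insert (Suc ?s) \<Gamma>"
    show ?thesis
    proof (intro exI[of _ ?G] conjI allI impI)
      show "?G \<subseteq> {Suc ?s..length w}" using \<Gamma>(1) n xpos by auto
      have "card ?G \<le> Suc (card \<Gamma>)" by (rule card_insert_le_m1) (auto simp: fin)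
      then show "card ?G + length ps \<le> length (parse f ps x)"
        using \<Gamma>(2) by (simp only: parse_step[OF False]) simp
      show "Suc ?s \<in> ?G" by simp
      fix i l assume il: "?s \<le> i \<and> 1 \<le> l \<and> i + l \<le> length w"
      show "(\<exists>p\<in>?G. i < p \<and> p \<le> i + l) \<or>
        (\<exists>i'. (i', i) \<in> R \<and> i' + l \<le> length w \<and> take l (drop i' w) = take l (drop i w))"
      proof (cases "i = ?s")
        case True
        then show ?thesis using il by auto
      next
        case ne: False
        show ?thesis
        proof (cases "length (concat ?ps) \<le> i")
          case True
          then show ?thesis using cov[of i l] il by blast
        next
          case inside: False
          then have "i < ?s + ?l" using s' by simp
          \<comment> \<open>An explicit symbol has no interior position, so the default length 1
            cannot be the one in force here.\<close>
          then have fl: "?l = f ps x" using ne il by (simp add: max_def split: if_splits)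
          show ?thesis
          proof (cases "i + l \<le> ?s + f ps x")
            case True
            show ?thesis using copy[OF less(2) _ _ True] ne il by auto
          next
            case over: False
            then have "?x \<noteq> []" using fl il n by auto
            moreover from this have "min ?l (length x) = ?l" by simp
            ultimately have "Suc (?s + ?l) \<in> \<Gamma>" using \<Gamma>(3) s' by simp
            then show ?thesis using over fl inside s' il \<open>i < ?s + ?l\<close> by (intro disjI1) (auto intro!: bexI[of _ "Suc (?s + ?l)"])
          qed
        qed
      qed
    qed
  qed
qed

lemma gamma_le_parse:
  assumes "wf R"
    and copy: "\<And>ps x i l. concat ps @ x = w \<Longrightarrow> length (concat ps) < i \<Longrightarrow> 1 \<le> l \<Longrightarrow>
      i + l \<le> length (concat ps) + f ps x \<Longrightarrow> i + l \<le> length w \<Longrightarrow>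
      \<exists>i'. (i', i) \<in> R \<and> i' + l \<le> length w \<and> take l (drop i' w) = take l (drop i w)"
  shows "gamma w \<le> length (parse f [] w)"
proof -
  have ex: "\<exists>\<Gamma>\<subseteq>{Suc (length (concat [] :: str))..length w}.
      card \<Gamma> + length ([] :: str list) \<le> length (parse f [] w) \<and>
      (w \<noteq> [] \<longrightarrow> Suc (length (concat [] :: str)) \<in> \<Gamma>) \<and>
      (\<forall>i l. length (concat [] :: str) \<le> i \<and> 1 \<le> l \<and> i + l \<le> length w \<longrightarrow>
        (\<exists>p\<in>\<Gamma>. i < p \<and> p \<le> i + l) \<or>
        (\<exists>i'. (i', i) \<in> R \<and> i' + l \<le> length w \<and> take l (drop i' w) = take l (drop i w)))"
    by (rule attractor_of_parse) (fact copy, simp)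
  obtain \<Gamma> where \<Gamma>: "\<Gamma> \<subseteq> {1..length w}" "card \<Gamma> \<le> length (parse f [] w)"
    "\<And>i l. 1 \<le> l \<Longrightarrow> i + l \<le> length w \<Longrightarrow>
        (\<exists>p\<in>\<Gamma>. i < p \<and> p \<le> i + l) \<or>
        (\<exists>i'. (i', i) \<in> R \<and> i' + l \<le> length w \<and> take l (drop i' w) = take l (drop i w))"
    using ex by auto
  have "string_attractor w \<Gamma>"
    using \<Gamma>(3) by (rule string_attractor_descent[OF \<Gamma>(1) \<open>wf R\<close>])
  then show ?thesis using gamma_le \<Gamma>(2) order_trans by blast
qed

lemma greedy_le: "greedy P ps x \<le> length x"
  unfolding greedy_def by (intro Max.boundedI) auto

lemma greedy_ge: "1 \<le> l \<Longrightarrow> l \<le> length x \<Longrightarrow> P ps x (take l x) \<Longrightarrow> l \<le> greedy P ps x"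
  unfolding greedy_def by (intro Max_ge) auto

lemma greedy_holds:
  assumes "1 \<le> greedy P ps x"
  shows "P ps x (take (greedy P ps x) x)"
proof -
  let ?A = "{l \<in> {1..length x}. P ps x (take l x)}"
  have "Max (insert 0 ?A) \<in> insert 0 ?A" by (intro Max_in) auto
  then show ?thesis using assms unfolding greedy_def by force
qed

lemma lz_end_imp_no: "lz_end_source ps x u \<Longrightarrow> lz_no_source ps x u"
  unfolding lz_end_source_def lz_no_source_def
  by (metis append_take_drop_id concat_append sublist_append_rightI sublist_order.order_trans suffix_imp_sublist)

lemma lz_no_imp_lz:
  assumes "lz_no_source ps x u" "u \<noteq> []"
  shows "lz_source ps x u"
proof -
  obtain a b where "concat ps = a @ u @ b"
    using assms by (auto simp: lz_no_source_def sublist_def)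
  with assms(2) show ?thesis
    unfolding lz_source_def by (intro bexI[of _ "Suc (length a)"]) (auto simp: Suc_le_eq)
qed

text \<open>A source starts before its phrase, even if it overlaps the phrase, so copying with a
  fixed offset moves every occurrence to the left. Sources of LZ-no and LZ-End are also sources of
  LZ, which is why one lemma covers the three parsings.\<close>

lemma gamma_le_greedy:
  assumes P: "\<And>ps x u. P ps x u \<Longrightarrow> u \<noteq> [] \<Longrightarrow> lz_source ps x u"
  shows "gamma w \<le> length (parse (greedy P) [] w)"
proof (rule gamma_le_parse[OF wf_less])
  fix ps x and i l :: nat
  let ?s = "length (concat ps)" and ?g = "greedy P ps x"
  assume w: "concat ps @ x = w" and i: "?s < i" and l: "1 \<le> l" "i + l \<le> ?s + ?g"
    and n: "i + l \<le> length w"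
  have g: "1 \<le> ?g" using i l by linarith
  have gx: "?g \<le> length x" by (rule greedy_le)
  then have "take ?g x \<noteq> []" using g by (cases x) auto
  with P greedy_holds[OF g] have "lz_source ps x (take ?g x)" by blast
  then obtain q where q: "1 \<le> q" "q \<le> ?s" "prefix (take ?g x) (drop (q - 1) w)"
    using w by (auto simp: lz_source_def)
  then have "take ?g (drop (q - 1) w) = take ?g (drop ?s w)"
    using w gx by (auto simp: prefix_def min_absorb2)
  then have "take l (drop (i - ?s) (take ?g (drop (q - 1) w))) =
      take l (drop (i - ?s) (take ?g (drop ?s w)))" by simp
  then have "take l (drop (q - 1 + (i - ?s)) w) = take l (drop i w)"
    using i l by (simp add: drop_take min_absorb1 add.commute)
  then show "\<exists>i'. (i', i) \<in> {(x, y). x < y} \<and> i' + l \<le> length w \<and> take l (drop i' w) = take l (drop i w)"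
    using q i n by (intro exI[of _ "q - 1 + (i - ?s)"]) auto
qed

lemma list_less_append_iff: "(u @ x < u @ y) \<longleftrightarrow> (x < (y :: str))"
  by (induction u) auto

lemma prefix_between:
  assumes "prefix u x" "prefix u y" "x \<le> z" "z \<le> (y::str)"
  shows "prefix u z"
  using assms
proof (induction u arbitrary: x y z)
  case (Cons a u)
  obtain x' where x: "x = a # x'" "prefix u x'" using Cons.prems(1) by (cases x) auto
  obtain y' where y: "y = a # y'" "prefix u y'" using Cons.prems(2) by (cases y) auto
  note xy = x y
  then obtain b z' where z: "z = b # z'" using Cons.prems by (cases z) auto
  have "b = a" "x' \<le> z'" "z' \<le> y'" using Cons.prems xy z by auto
  then show ?case using Cons.IH[of x' y' z'] xy z by simp
qed simp

lemma finite_lex_smaller: "finite (lex_smaller_suffixes w x)"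
  by (rule finite_subset[of _ "set (suffixes w)"]) (auto simp: lex_smaller_suffixes_def)

text \<open>The immediate predecessor of \<open>x\<close> lies between any smaller suffix and
  \<open>x\<close>. Words with a common prefix form an interval of the order, so the predecessor has
  that prefix as well.\<close>

lemma lex_length_ge:
  assumes "y \<in> lex_smaller_suffixes (concat ps @ x) x" "prefix u y" "prefix u x"
  shows "length u \<le> lex_length ps x"
proof -
  let ?Y = "lex_smaller_suffixes (concat ps @ x) x"
  have "y \<le> Max ?Y" "Max ?Y \<in> ?Y"
    using assms(1) finite_lex_smaller Max_in by auto
  then have "prefix u (Max ?Y)"
    using prefix_between[OF assms(2,3)] by (auto simp: lex_smaller_suffixes_def)
  then have "prefix u (longest_common_prefix x (Max ?Y))"
    using assms(3) longest_common_prefix_max_prefix by blast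
  then show ?thesis using assms(1) by (auto simp: lex_length_def Let_def prefix_length_le)
qed

text \<open>\<open>E\<close> is a set of checkpoints, given as lengths of parsed text. Each phrase
  passes a checkpoint beyond its own start, and no later phrase can count that one again. The
  invariant \<open>I\<close> records what the phrases parsed so far offer as sources.\<close>

lemma length_parse_le_card:
  assumes E: "finite E"
    and reach: "\<And>ps x. I ps \<Longrightarrow> concat ps @ x = w \<Longrightarrow> x \<noteq> [] \<Longrightarrow>
      \<exists>e\<in>E. length (concat ps) < e \<and> e \<le> length (concat ps) + max 1 (f ps x) \<and> e \<le> length w"
    and inv: "\<And>ps x. I ps \<Longrightarrow> concat ps @ x = w \<Longrightarrow> x \<noteq> [] \<Longrightarrow> I (ps @ [take (max 1 (f ps x)) x])"
    and "I ps" "concat ps @ x = w"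
  shows "length (parse f ps x) \<le> length ps + card {e\<in>E. length (concat ps) < e}"
  using assms(4,5)
proof (induction "length x" arbitrary: ps x rule: less_induct)
  case less
  show ?case
  proof (cases "x = []")
    case False
    let ?l = "max 1 (f ps x)" and ?s = "length (concat ps)"
    let ?ps = "ps @ [take ?l x]" and ?x = "drop ?l x"
    have shorter: "length ?x < length x" using False by (cases x) auto
    obtain e where e: "e \<in> E" "?s < e" "e \<le> ?s + ?l" "e \<le> length w"
      using reach[OF less(2,3) False] by blast
    have n: "length w = ?s + length x" using less(3) by auto
    have s': "length (concat ?ps) = ?s + min ?l (length x)" by (simp add: min.commute)
    have "{d\<in>E. length (concat ?ps) < d} \<subseteq> {d\<in>E. ?s < d} - {e}"
      using e n s' by auto
    then have "card {d\<in>E. length (concat ?ps) < d} \<le> card ({d\<in>E. ?s < d} - {e})"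
      using E by (intro card_mono) auto
    also have "\<dots> < card {d\<in>E. ?s < d}"
      using E e by (intro card_Diff1_less) auto
    finally have "Suc (card {d\<in>E. length (concat ?ps) < d}) \<le> card {d\<in>E. ?s < d}" by simp
    moreover have "length (parse f ?ps ?x) \<le> length ?ps + card {d\<in>E. length (concat ?ps) < d}"
      using less(1)[OF shorter inv[OF less(2,3) False]] less(3) by simp
    ultimately show ?thesis by (simp only: parse_step[OF False]) simp
  qed (simp add: parse_Nil)
qed

text \<open>A source may lie to the right of its phrase, so positions do not decrease. The rank of
  the suffix does: removing \<open>m\<close> symbols of the common prefix from both suffixes keeps
  their order.\<close>

lemma gamma_le_lex_v: "gamma w \<le> lex_v w"
  unfolding lex_v_def
proof (rule gamma_le_parse[OF wf_measure[of "\<lambda>i. card (lex_smaller_suffixes w (drop i w))"]])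
  let ?R = "measure (\<lambda>i. card (lex_smaller_suffixes w (drop i w)))"
  fix ps x and i l :: nat
  let ?s = "length (concat ps)" and ?g = "lex_length ps x"
  assume w: "concat ps @ x = w" and i: "?s < i" and l: "1 \<le> l" "i + l \<le> ?s + ?g"
    and n: "i + l \<le> length w"
  define y where "y = Max (lex_smaller_suffixes w x)"
  have g: "?g \<noteq> 0" using i l by linarith
  have gdef: "?g = (if lex_smaller_suffixes w x = {} then 0 else length (longest_common_prefix x y))"
    by (simp only: lex_length_def Let_def y_def w)
  with g have ne: "lex_smaller_suffixes w x \<noteq> {}" by metis
  with gdef have lcp: "?g = length (longest_common_prefix x y)" by simp
  have "y \<in> lex_smaller_suffixes w x"
    unfolding y_def using finite_lex_smaller ne by (rule Max_in)
  then have y: "suffix y w" "y < x" by (auto simp: lex_smaller_suffixes_def)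
  obtain v where "w = v @ y" using y(1) by (auto simp: suffix_def)
  then have q: "y = drop (length v) w" by simp
  define q where "q = length v"
  note q = q[folded q_def]
  define u where "u = longest_common_prefix x y"
  have xd: "x = drop ?s w" using w by auto
  have "prefix u x" "prefix u y"
    unfolding u_def by (rule longest_common_prefix_prefix1 longest_common_prefix_prefix2)+
  then obtain x' y' where x': "x = u @ x'" and y': "y = u @ y'"
    by (elim prefixE)
  define m where "m = i - ?s"
  have ml: "m + l \<le> length u" using i l lcp by (simp add: m_def u_def)
  have di: "drop i w = drop m u @ x'"
  proof -
    have "drop i w = drop m x" using xd i by (simp add: m_def)
    then show ?thesis using x' ml by simp
  qed
  have dq: "drop (q + m) w = drop m u @ y'"
  proof -
    have "drop (q + m) w = drop m y" using q by (simp add: add.commute)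
    then show ?thesis using y' ml by simp
  qed
  have "y' < x'" using y(2) x' y' by (simp add: list_less_append_iff)
  then have less: "drop (q + m) w < drop i w" using di dq by (simp add: list_less_append_iff)
  have copy: "take l (drop (q + m) w) = take l (drop i w)" using di dq ml by simp
  have len: "q + m + l \<le> length w"
  proof -
    have "l \<le> length (drop (q + m) w)" using dq ml by simp
    then show ?thesis using l by simp
  qed
  have "lex_smaller_suffixes w (drop (q + m) w) \<subset> lex_smaller_suffixes w (drop i w)"
  proof (rule psubsetI)
    show "lex_smaller_suffixes w (drop (q + m) w) \<subseteq> lex_smaller_suffixes w (drop i w)"
      using less by (auto simp: lex_smaller_suffixes_def)
    have "drop (q + m) w \<noteq> []" using len l by simp
    then have "drop (q + m) w \<in> lex_smaller_suffixes w (drop i w)"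
      using less suffix_drop by (auto simp: lex_smaller_suffixes_def)
    moreover have "drop (q + m) w \<notin> lex_smaller_suffixes w (drop (q + m) w)"
      by (simp add: lex_smaller_suffixes_def)
    ultimately show "lex_smaller_suffixes w (drop (q + m) w) \<noteq> lex_smaller_suffixes w (drop i w)"
      by metis
  qed
  then have "(q + m, i) \<in> ?R" by (simp add: psubset_card_mono finite_lex_smaller)
  with copy len show "\<exists>i'. (i', i) \<in> ?R \<and> i' + l \<le> length w \<and> take l (drop i' w) = take l (drop i w)"
    by blast
qed

section \<open>Grammars\<close>

lemma derives_SeqE:
  assumes "derives G (Var A) v" "gr_rule G A = Seq Xs"
  obtains us where "v = concat us" "list_all2 (derives G) Xs us"
  using assms by (cases rule: derives.cases) simp_all

lemma derives_RunE:
  assumes "derives G (Var A) v" "gr_rule G A = Run X m"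
  obtains u where "v = concat (replicate m u)" "derives G X u"
  using assms by (cases rule: derives.cases) simp_all

lemma derives_PreE:
  assumes "derives G (Var A) v" "gr_rule G A = Pre B t"
  obtains u where "v = take t u" "derives G (Var B) u"
  using assms by (cases rule: derives.cases) simp_all

lemma derives_SufE:
  assumes "derives G (Var A) v" "gr_rule G A = Suf B t"
  obtains u where "v = drop (length u - t) u" "derives G (Var B) u"
  using assms by (cases rule: derives.cases) simp_all

lemma derives_unique: "derives G X u \<Longrightarrow> derives G X v \<Longrightarrow> u = v"
proof (induction arbitrary: v rule: derives.induct)
  case (terminal a)
  then show ?case by (auto elim: derives.cases)
next
  case (seq A Xs us)
  obtain vs where v: "v = concat vs" and vs: "list_all2 (derives G) Xs vs"
    by (rule derives_SeqE[OF seq.prems seq.hyps(2)])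
  have "list_all2 (\<lambda>x y. derives G x y \<and> (\<forall>z. derives G x z \<longrightarrow> y = z)) Xs us"
    using seq(3) by (rule list_all2_mono) auto
  then have len: "length Xs = length us"
    and eq: "\<And>i z. i < length us \<Longrightarrow> derives G (Xs ! i) z \<Longrightarrow> us ! i = z"
    by (simp_all add: list_all2_conv_all_nth)
  have "us = vs"
  proof (rule nth_equalityI)
    show "length us = length vs" using len list_all2_lengthD[OF vs] by simp
    show "us ! i = vs ! i" if "i < length us" for i
      using eq[OF that] list_all2_nthD[OF vs] that len by simp
  qed
  then show ?case by (simp only: v)
next
  case (run A X m u)
  obtain u' where "v = concat (replicate m u')" "derives G X u'"
    by (rule derives_RunE[OF run.prems run.hyps(2)])
  then show ?case using run.IH by metis
next
  case (prefix_rule A B t u)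
  obtain u' where "v = take t u'" "derives G (Var B) u'"
    by (rule derives_PreE[OF prefix_rule.prems prefix_rule.hyps(2)])
  then show ?case using prefix_rule.IH by metis
next
  case (suffix_rule A B t u)
  obtain u' where "v = drop (length u' - t) u'" "derives G (Var B) u'"
    by (rule derives_SufE[OF suffix_rule.prems suffix_rule.hyps(2)])
  then show ?case using suffix_rule.IH by metis
qed

lemma derives_Term: "derives G (Term a) u \<longleftrightarrow> u = [a]"
  by (auto elim: derives.cases intro: derives.intros)

fun rhs_syms :: "rhs \<Rightarrow> gsym set" where
  "rhs_syms (Seq Xs) = set Xs"
| "rhs_syms (Run X m) = {X}"
| "rhs_syms (Pre B t) = {Var B}"
| "rhs_syms (Suf B t) = {Var B}"

text \<open>This is the charging scheme for grammars: a factor is charged to a variable where it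
  first crosses a border between the parts of the expansion. Truncation rules are charged nothing,
  since a prefix or suffix has no factors of its own.\<close>

definition new_factors :: "grammar \<Rightarrow> nat \<Rightarrow> nat \<Rightarrow> str set" where
  "new_factors G k A = {t. (\<exists>u. derives G (Var A) u \<and> t \<in> factors k u) \<and>
     \<not> (\<exists>X v. X \<in> rhs_syms (gr_rule G A) \<and> derives G X v \<and> t \<in> factors k v)}"

text \<open>Descend from an expansion to its parts for as long as some part still contains the
  factor. The descent ends where the factor is new, or at a terminal, the latter only for factors of
  length 1. Charged factors that truncation removes later only make the count larger.\<close>

lemma factors_subset_new_factors:
  assumes "derives G X u" "1 \<le> k"
  shows "t \<in> factors k u \<Longrightarrow> t \<in> (\<Union>A\<in>gr_vars G. new_factors G k A) \<or>
    (\<exists>A\<in>gr_vars G. \<exists>a. Term a \<in> rhs_syms (gr_rule G A) \<and> t = [a]) \<or> (\<exists>a. X = Term a \<and> t = [a])"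
  using assms(1)
proof (induction arbitrary: t rule: derives.induct)
  case (terminal a)
  then show ?case using assms(2)
    by (cases t) (auto simp: factors_def sublist_Cons_right prefix_Cons)
next
  case (seq A Xs us)
  have d: "derives G (Var A) (concat us)"
    using seq by (auto intro!: derives.seq elim: list_all2_mono)
  show ?case
  proof (cases "\<exists>X v. X \<in> set Xs \<and> derives G X v \<and> t \<in> factors k v")
    case True
    then obtain X v where X: "X \<in> set Xs" "derives G X v" "t \<in> factors k v" by blast
    then obtain i where "i < length Xs" "X = Xs ! i" by (auto simp: in_set_conv_nth)
    then have "us ! i = v" and IH: "\<And>t. t \<in> factors k (us ! i) \<Longrightarrow>
       t \<in> (\<Union>A\<in>gr_vars G. new_factors G k A) \<or>
    (\<exists>A\<in>gr_vars G. \<exists>a. Term a \<in> rhs_syms (gr_rule G A) \<and> t = [a]) \<or> (\<exists>a. X = Term a \<and> t = [a])"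
      using seq(3) X(2) derives_unique by (auto simp: list_all2_conv_all_nth)
    then have "t \<in> (\<Union>A\<in>gr_vars G. new_factors G k A) \<or>
    (\<exists>A\<in>gr_vars G. \<exists>a. Term a \<in> rhs_syms (gr_rule G A) \<and> t = [a]) \<or> (\<exists>a. X = Term a \<and> t = [a])"
      using X(3) by blast
    then show ?thesis using X(1) seq(1,2) by (metis rhs_syms.simps(1))
  next
    case False
    then show ?thesis using d seq by (auto simp: new_factors_def)
  qed
next
  case (run A X m u)
  have d: "derives G (Var A) (concat (replicate m u))"
    using derives.run run(1,2,3) by blast
  show ?case
  proof (cases "t \<in> factors k u")
    case True
    from run.IH[OF this] run(1,2) show ?thesis
      by (metis (no_types, lifting) insertI1 rhs_syms.simps(2))
  next
    case False
    then have "\<not> (\<exists>X v. X \<in> rhs_syms (gr_rule G A) \<and> derives G X v \<and> t \<in> factors k v)"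
      using derives_unique[OF run(3)] run(2) by auto
    then have "t \<in> new_factors G k A"
      using d run(5) unfolding new_factors_def by blast
    then show ?thesis using run(1) by blast
  qed
next
  case (prefix_rule A B l u)
  have "t \<in> factors k u"
    using prefix_rule(6) by (auto simp: factors_def intro: sublist_order.order_trans sublist_take)
  with prefix_rule.IH[OF this] show ?case by auto
next
  case (suffix_rule A B l u)
  have "t \<in> factors k u"
    using suffix_rule(6) by (auto simp: factors_def intro: sublist_order.order_trans sublist_drop)
  with suffix_rule.IH[OF this] show ?case by auto
qed

lemma factor_concat:
  assumes "i + k \<le> length (concat us)" "1 \<le> k"
  shows "(\<exists>v\<in>set us. take k (drop i (concat us)) \<in> factors k v) \<or>
    (\<exists>j<length us. \<exists>q<k. i + q = length (concat (take j us)))"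
  using assms(1)
proof (induction us arbitrary: i)
  case Nil
  then show ?case using assms(2) by simp
next
  case (Cons u us)
  show ?case
  proof (cases "length u \<le> i")
    case True
    then obtain i' where i': "i = length u + i'" by (metis le_add_diff_inverse)
    then have "i' + k \<le> length (concat us)" using Cons.prems by simp
    from Cons.IH[OF this] show ?thesis
    proof
      assume "\<exists>v\<in>set us. take k (drop i' (concat us)) \<in> factors k v"
      then show ?thesis using i' by auto
    next
      assume "\<exists>j<length us. \<exists>q<k. i' + q = length (concat (take j us))"
      then obtain j q where "j < length us" "q < k" "i' + q = length (concat (take j us))" by blast
      then show ?thesis using i'
        by (intro disjI2 exI[of _ "Suc j"] conjI exI[of _ q]) auto
    qed
  next
    case False
    show ?thesis
    proof (cases "i + k \<le> length u")
      case True
      then have "take k (drop i (concat (u # us))) = take k (drop i u)" by simp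
      moreover have "take k (drop i u) \<in> factors k u"
        using True by (auto simp: factors_def sublist_take_drop)
      ultimately show ?thesis by (metis list.set_intros(1))
    next
      case over: False
      then have "us \<noteq> []" using Cons.prems by auto
      then show ?thesis using over False
        by (intro disjI2 exI[of _ 1] conjI exI[of _ "length u - i"]) auto
    qed
  qed
qed

text \<open>A new factor fits into no part, so it starts \<open>q < k\<close> symbols before the
  beginning of some part \<open>j\<close>. The pair of \<open>j\<close> and \<open>q\<close>
  determines it.\<close>

lemma card_new_factors_Seq:
  assumes "gr_rule G A = Seq Xs" "1 \<le> k"
  shows "card (new_factors G k A) \<le> length Xs * k"
proof (cases "\<exists>u. derives G (Var A) u")
  case True
  then obtain u where u: "derives G (Var A) u" ..
  obtain us where us: "u = concat us" "list_all2 (derives G) Xs us"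
    by (rule derives_SeqE[OF u assms(1)])
  let ?F = "(\<lambda>(j, q). take k (drop (length (concat (take j us)) - q) u)) ` ({..<length Xs} \<times> {..<k})"
  have "new_factors G k A \<subseteq> ?F"
  proof
    fix t assume t: "t \<in> new_factors G k A"
    then obtain u' where "derives G (Var A) u'" "t \<in> factors k u'" by (auto simp: new_factors_def)
    then have tu: "t \<in> factors k u" using derives_unique u by blast
    then obtain i where i: "i + k \<le> length u" "t = take k (drop i u)"
      unfolding factors_def sublist_iff_take_drop by auto
    have "\<not> (\<exists>v\<in>set us. t \<in> factors k v)"
    proof
      assume "\<exists>v\<in>set us. t \<in> factors k v"
      then obtain j where "j < length us" "t \<in> factors k (us ! j)" by (auto simp: in_set_conv_nth)
      moreover from this have "derives G (Xs ! j) (us ! j)" "Xs ! j \<in> set Xs"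
        using us(2) by (auto simp: list_all2_conv_all_nth)
      ultimately show False using t assms(1) by (auto simp: new_factors_def)
    qed
    then obtain j q where jq: "j < length us" "q < k" "i + q = length (concat (take j us))"
      using factor_concat[of i k us] i us(1) assms(2) by auto
    have "i = length (concat (take j us)) - q" using jq(3) by linarith
    then show "t \<in> ?F" using i jq us list_all2_lengthD[OF us(2)]
      by (intro image_eqI[of _ _ "(j, q)"]) auto
  qed
  then have "card (new_factors G k A) \<le> card ?F" by (intro card_mono) auto
  also have "\<dots> \<le> card ({..<length Xs} \<times> {..<k})" by (intro card_image_le) auto
  finally show ?thesis by (simp add: card_cartesian_product)
qed (auto simp: new_factors_def)

lemma concat_replicate_add:
  "concat (replicate (a + b) u) = concat (replicate a u) @ concat (replicate b u)"
  by (simp add: replicate_add)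

lemma length_concat_replicate: "length (concat (replicate m u)) = m * length u"
  by (induction m) auto

lemma factor_power_shift:
  assumes "i + k \<le> length (concat (replicate m u))" "u \<noteq> []"
  shows "take k (drop i (concat (replicate m u))) = take k (drop (i mod length u) (concat (replicate m u)))"
proof (cases "k = 0")
  case False
  let ?r = "i mod length u" and ?a = "i div length u"
  have lu: "0 < length u" using assms(2) by simp
  have im: "i < m * length u" using assms(1) False by (simp add: length_concat_replicate)
  then have am: "?a < m" using lu by (simp add: div_less_iff_less_mult)
  then obtain b where b: "m = ?a + b" by (metis less_imp_le le_Suc_ex)
  have ia: "i = ?a * length u + ?r" by simp
  have "drop i (concat (replicate m u)) = drop ?r (drop (?a * length u) (concat (replicate m u)))"
    using ia by (metis drop_drop add.commute)
  also have "drop (?a * length u) (concat (replicate m u)) = concat (replicate b u)"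
    by (subst b, subst concat_replicate_add) (simp add: length_concat_replicate)
  finally have 1: "drop i (concat (replicate m u)) = drop ?r (concat (replicate b u))" .
  have rk: "?r + k \<le> length (concat (replicate b u))"
  proof -
    have "m * length u = ?a * length u + b * length u" using b by (metis add_mult_distrib)
    then show ?thesis using assms(1) ia by (simp only: length_concat_replicate)
  qed
  have "concat (replicate m u) = concat (replicate b u) @ concat (replicate ?a u)"
    by (subst b, subst add.commute, rule concat_replicate_add)
  then have "take k (drop ?r (concat (replicate m u))) = take k (drop ?r (concat (replicate b u)))"
    using rk by simp
  then show ?thesis using 1 by simp
qed simp

text \<open>By periodicity an occurrence can be moved so that it starts in the first copy of the
  period. A new factor does not fit into this copy, so it starts fewer than \<open>k\<close> symbols
  before the end of the copy. This leaves \<open>k\<close> candidates for any exponent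
  \<open>m\<close>.\<close>

lemma card_new_factors_Run:
  assumes "gr_rule G A = Run X m" "1 \<le> k"
  shows "card (new_factors G k A) \<le> k"
proof (cases "\<exists>u. derives G (Var A) u")
  case True
  then obtain u where u: "derives G (Var A) u" ..
  obtain v where v: "u = concat (replicate m v)" "derives G X v"
    by (rule derives_RunE[OF u assms(1)])
  let ?F = "(\<lambda>q. take k (drop (length v - q) u)) ` {..<k}"
  have "new_factors G k A \<subseteq> ?F"
  proof
    fix t assume t: "t \<in> new_factors G k A"
    then obtain u' where "derives G (Var A) u'" "t \<in> factors k u'" by (auto simp: new_factors_def)
    then have tu: "t \<in> factors k u" using derives_unique u by blast
    then obtain i where i: "i + k \<le> length u" "t = take k (drop i u)"
      unfolding factors_def sublist_iff_take_drop by auto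
    have "v \<noteq> []" using i v(1) assms(2) by auto
    then have tr: "t = take k (drop (i mod length v) u)" and r: "i mod length v < length v"
      using factor_power_shift[of i k m v] i v(1) by auto
    have tv: "t \<notin> factors k v" using t v(2) assms(1) by (auto simp: new_factors_def)
    have "\<not> i mod length v + k \<le> length v"
    proof
      assume le: "i mod length v + k \<le> length v"
      have "u \<noteq> []" using i assms(2) by auto
      then have "m \<noteq> 0" using v by (auto intro: ccontr)
      then obtain m' where m': "m = Suc m'" by (cases m) auto
      have "t = take k (drop (i mod length v) v)" using tr v(1) m' le by simp
      then have "t \<in> factors k v" using le by (auto simp: factors_def sublist_take_drop)
      with tv show False ..
    qed
    then have "length v - i mod length v < k" "i mod length v = length v - (length v - i mod length v)"
      using r by linarith+
    then show "t \<in> ?F" using tr by (intro image_eqI[of _ _ "length v - i mod length v"]) auto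
  qed
  then have "card (new_factors G k A) \<le> card ?F" by (intro card_mono) auto
  also have "\<dots> \<le> card {..<k}" by (intro card_image_le) auto
  finally show ?thesis by simp
qed (auto simp: new_factors_def)

lemma new_factors_Pre: "gr_rule G A = Pre B l \<Longrightarrow> new_factors G k A = {}"
proof (rule ccontr)
  assume r: "gr_rule G A = Pre B l" and "new_factors G k A \<noteq> {}"
  then obtain t u where t: "t \<in> new_factors G k A" "derives G (Var A) u" "t \<in> factors k u"
    by (auto simp: new_factors_def)
  obtain v where v: "u = take l v" "derives G (Var B) v"
    by (rule derives_PreE[OF t(2) r])
  then have "t \<in> factors k v"
    using t(3) by (auto simp: factors_def intro: sublist_order.order_trans sublist_take)
  then show False using t(1) v(2) r by (auto simp: new_factors_def)
qed

lemma new_factors_Suf: "gr_rule G A = Suf B l \<Longrightarrow> new_factors G k A = {}"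
proof (rule ccontr)
  assume r: "gr_rule G A = Suf B l" and "new_factors G k A \<noteq> {}"
  then obtain t u where t: "t \<in> new_factors G k A" "derives G (Var A) u" "t \<in> factors k u"
    by (auto simp: new_factors_def)
  obtain v where v: "u = drop (length v - l) v" "derives G (Var B) v"
    by (rule derives_SufE[OF t(2) r])
  then have "t \<in> factors k v"
    using t(3) by (auto simp: factors_def intro: sublist_order.order_trans sublist_drop)
  then show False using t(1) v(2) r by (auto simp: new_factors_def)
qed

lemma card_new_factors_le:
  assumes "1 \<le> k"
  shows "card (new_factors G k A) \<le> rhs_size (gr_rule G A) * k"
proof (cases "gr_rule G A")
  case (Seq Xs)
  then show ?thesis using card_new_factors_Seq[OF Seq assms] by simp
next
  case (Run X m)
  then show ?thesis using card_new_factors_Run[OF Run assms] by simp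
qed (auto simp: new_factors_Pre new_factors_Suf)

lemma card_rhs_terminals: "card {[a] | a. Term a \<in> rhs_syms r} \<le> rhs_size r" "finite {[a] | a. Term a \<in> rhs_syms r}"
proof -
  let ?f = "\<lambda>X. case X of Term a \<Rightarrow> [a] | Var A \<Rightarrow> []"
  have sub: "{[a] | a. Term a \<in> rhs_syms r} \<subseteq> ?f ` rhs_syms r"
    by (force intro: image_eqI)
  have fin: "finite (rhs_syms r)" by (cases r) auto
  have "card {[a] | a. Term a \<in> rhs_syms r} \<le> card (?f ` rhs_syms r)"
    using sub fin by (intro card_mono) auto
  also have "\<dots> \<le> card (rhs_syms r)" by (rule card_image_le[OF fin])
  also have "\<dots> \<le> rhs_size r" by (cases r) (auto simp: card_length)
  finally show "card {[a] | a. Term a \<in> rhs_syms r} \<le> rhs_size r" .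
  show "finite {[a] | a. Term a \<in> rhs_syms r}" using sub fin finite_subset by blast
qed

text \<open>One half of the bound pays for the new factors, the other for the single symbols that
  terminals contribute directly.\<close>

lemma card_factors_le_gr_size:
  assumes G: "collage_system G" "gr_generates G w" and k: "1 \<le> k"
  shows "card (factors k w) \<le> 2 * gr_size G * k"
proof -
  let ?V = "gr_vars G"
  let ?N = "\<lambda>A. new_factors G k A \<inter> factors k w" and ?T = "\<lambda>A. {[a] | a. Term a \<in> rhs_syms (gr_rule G A)}"
  have fin: "finite ?V" using G by (auto simp: collage_system_def)
  have "factors k w \<subseteq> (\<Union>A\<in>?V. ?N A) \<union> (\<Union>A\<in>?V. ?T A)"
  proof
    fix t assume t: "t \<in> factors k w"
    have "derives G (Var (gr_start G)) w" using G(2) by (simp add: gr_generates_def)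
    from factors_subset_new_factors[OF this k t]
    show "t \<in> (\<Union>A\<in>?V. ?N A) \<union> (\<Union>A\<in>?V. ?T A)"
      using t by (elim disjE) auto
  qed
  then have "card (factors k w) \<le> card ((\<Union>A\<in>?V. ?N A) \<union> (\<Union>A\<in>?V. ?T A))"
    using fin card_rhs_terminals(2) finite_factors by (intro card_mono) auto
  also have "\<dots> \<le> card (\<Union>A\<in>?V. ?N A) + card (\<Union>A\<in>?V. ?T A)" by (rule card_Un_le)
  also have "\<dots> \<le> (\<Sum>A\<in>?V. card (?N A)) + (\<Sum>A\<in>?V. card (?T A))"
    using fin by (intro add_mono card_UN_le)
  also have "(\<Sum>A\<in>?V. card (?N A)) \<le> (\<Sum>A\<in>?V. rhs_size (gr_rule G A) * k)"
  proof (rule sum_mono)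
    fix A
    have fA: "finite (new_factors G k A)"
    proof (cases "\<exists>u. derives G (Var A) u")
      case True
      then obtain u where "derives G (Var A) u" ..
      then have "new_factors G k A \<subseteq> factors k u"
        using derives_unique by (auto simp: new_factors_def)
      then show ?thesis using finite_factors finite_subset by blast
    qed (auto simp: new_factors_def)
    have "card (?N A) \<le> card (new_factors G k A)" using fA by (intro card_mono) auto
    also have "\<dots> \<le> rhs_size (gr_rule G A) * k" by (rule card_new_factors_le[OF k])
    finally show "card (?N A) \<le> rhs_size (gr_rule G A) * k" .
  qed
  also have "(\<Sum>A\<in>?V. card (?T A)) \<le> (\<Sum>A\<in>?V. rhs_size (gr_rule G A) * k)"
  proof (rule sum_mono)
    fix A
    have "card (?T A) \<le> rhs_size (gr_rule G A)" by (rule card_rhs_terminals)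
    also have "\<dots> \<le> rhs_size (gr_rule G A) * k" using k by simp
    finally show "card (?T A) \<le> rhs_size (gr_rule G A) * k" .
  qed
  finally show ?thesis by (simp add: gr_size_def flip: sum_distrib_right)
qed

lemma explicit_slp:
  assumes "w \<noteq> []"
  shows "\<exists>G. slp G \<and> gr_generates G w"
proof -
  define G where "G = \<lparr>gr_vars = {0}, gr_rule = (\<lambda>_. Seq (map Term w)), gr_start = 0\<rparr>"
  have "list_all2 (derives G) (map Term w) (map (\<lambda>a. [a]) w)"
    by (auto simp: list_all2_conv_all_nth derives_Term)
  then have "derives G (Var 0) (concat (map (\<lambda>a. [a]) w))"
    by (intro derives.seq[of 0 G]) (auto simp: G_def)
  then have "gr_generates G w" by (simp add: gr_generates_def G_def)
  moreover have "slp G" using assms by (auto simp: slp_def collage_system_def G_def)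
  ultimately show ?thesis by blast
qed

lemma slp_g_attained:
  assumes "w \<noteq> []"
  obtains G where "slp G" "gr_generates G w" "slp_g w = gr_size G"
proof -
  have "slp_g w \<in> {gr_size G | G. slp G \<and> gr_generates G w}"
    unfolding slp_g_def using explicit_slp[OF assms] by (intro Inf_nat_def1) blast
  with that show ?thesis by blast
qed

lemma slp_imp_rlslp: "slp G \<Longrightarrow> rlslp G"
  unfolding slp_def rlslp_def by blast

lemma rlslp_g_attained:
  assumes "w \<noteq> []"
  obtains G where "rlslp G" "gr_generates G w" "rlslp_g w = gr_size G"
proof -
  have "rlslp_g w \<in> {gr_size G | G. rlslp G \<and> gr_generates G w}"
    unfolding rlslp_g_def using explicit_slp[OF assms] slp_imp_rlslp by (intro Inf_nat_def1) blast
  with that show ?thesis by blast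
qed

lemma collage_c_attained:
  assumes "w \<noteq> []"
  obtains G where "collage_system G" "gr_generates G w" "collage_c w = gr_size G"
proof -
  have "collage_c w \<in> {gr_size G | G. collage_system G \<and> gr_generates G w}"
    unfolding collage_c_def using explicit_slp[OF assms] by (intro Inf_nat_def1) (auto simp: slp_def)
  with that show ?thesis by blast
qed

lemma rlslp_g_le: "rlslp G \<Longrightarrow> gr_generates G w \<Longrightarrow> rlslp_g w \<le> gr_size G"
  unfolding rlslp_g_def by (rule Inf_nat_lower) blast

lemma collage_c_le_rlslp_g:
  assumes "w \<noteq> []"
  shows "collage_c w \<le> rlslp_g w"
proof -
  obtain G where G: "rlslp G" "gr_generates G w" "rlslp_g w = gr_size G"
    using rlslp_g_attained[OF assms] by blast
  have "collage_c w \<le> gr_size G"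
    unfolding collage_c_def using G by (intro Inf_nat_lower) (auto simp: rlslp_def)
  then show ?thesis using G by simp
qed

lemma delta_le_collage_c:
  assumes "w \<noteq> []"
  shows "delta w \<le> 2 * real (collage_c w)"
proof -
  obtain G where G: "collage_system G" "gr_generates G w" "collage_c w = gr_size G"
    using collage_c_attained[OF assms] by blast
  show ?thesis
  proof (rule delta_le[OF assms])
    fix k :: nat assume "1 \<le> k"
    from card_factors_le_gr_size[OF G(1,2) this]
    have "real (card (factors k w)) \<le> real (2 * gr_size G * k)" by (simp only: of_nat_le_iff)
    then show "real (card (factors k w)) \<le> 2 * real (collage_c w) * real k" using G by simp
  qed
qed

section \<open>The Burrows-Wheeler transform\<close>

definition bwt_rows :: "str \<Rightarrow> str list" where
  "bwt_rows w = sort (map (\<lambda>i. rotate i w) [0..<length w])"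

lemma bwt_eq: "bwt w = map last (bwt_rows w)"
  by (simp add: bwt_def bwt_rows_def)

lemma set_bwt_rows: "set (bwt_rows w) = (\<lambda>i. rotate i w) ` {..<length w}"
  by (auto simp: bwt_rows_def)

lemma length_bwt_row: "x \<in> set (bwt_rows w) \<Longrightarrow> length x = length w"
  by (auto simp: set_bwt_rows)

lemma rotate1_bwt_rows:
  "set (bwt_rows w) = rotate1 ` set (bwt_rows w)"
proof (cases "w = []")
  case False
  then have n: "0 < length w" by simp
  have "(\<lambda>i. rotate i w) ` {..<length w} = range (\<lambda>i. rotate i w)"
    using rotate_conv_mod[of _ w] n
    by (auto intro!: image_eqI[of _ _ "_ mod length w"])
  moreover have "range (\<lambda>i. rotate i w) \<subseteq> rotate1 ` range (\<lambda>i. rotate i w)"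
  proof clarify
    fix i
    have "rotate i w = rotate (i + length w) w"
      using rotate_conv_mod[of i w] rotate_conv_mod[of "i + length w" w] by simp
    also have "\<dots> = rotate1 (rotate (i + length w - 1) w)"
      using n by (metis One_nat_def Suc_pred add_gr_0 rotate_Suc)
    finally show "rotate i w \<in> rotate1 ` range (\<lambda>i. rotate i w)" by blast
  qed
  moreover have "rotate1 ` range (\<lambda>i. rotate i w) \<subseteq> range (\<lambda>i. rotate i w)"
    by (auto simp flip: rotate_Suc)
  ultimately show ?thesis by (simp add: set_bwt_rows)
qed (simp add: bwt_rows_def)

text \<open>A non-empty list has one run more than it has changes, and the zipped list changes only
  where one of its components does; hence the \<open>- 1\<close>.\<close>

lemma length_remdups_adj_Pair:
  "length (remdups_adj (zip xs ys)) \<le> length (remdups_adj xs) + length (remdups_adj ys) - 1"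
  if "length xs = length ys"
  using that
proof (induction xs ys rule: list_induct2)
  case (Cons x xs y ys)
  show ?case
  proof (cases xs)
    case (Cons x' xs')
    then obtain y' ys' where ys: "ys = y' # ys'" using Cons.hyps by (cases ys) auto
    obtain p q where "length (remdups_adj (x' # xs')) = Suc p" "length (remdups_adj (y' # ys')) = Suc q"
      by (cases "remdups_adj (x' # xs')"; cases "remdups_adj (y' # ys')") auto
    then show ?thesis using Cons.IH Cons ys by auto
  qed (use Cons.hyps in simp)
qed simp

lemma card_set_le_remdups_adj: "card (set xs) \<le> length (remdups_adj xs)"
  by (metis card_length remdups_adj_set)

lemma length_remdups_adj_sorted:
  "sorted xs \<Longrightarrow> length (remdups_adj xs) = card (set (xs :: 'a :: linorder list))"
proof (induction xs rule: remdups_adj.induct)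
  case (3 x y xs)
  show ?case
  proof (cases "x = y")
    case False
    then have "x \<notin> set (y # xs)" using 3 by fastforce
    then show ?thesis using 3 False by simp
  qed (use 3 in simp)
qed simp_all

lemma take_mono_str: "x \<le> y \<Longrightarrow> take k x \<le> take k (y :: str)"
proof (induction k arbitrary: x y)
  case (Suc k)
  then show ?case by (cases x; cases y) auto
qed simp

text \<open>
  The prefixes of length \<open>k + 1\<close> of the rotations are the pairs of the last symbol and the prefix
  of length \<open>k\<close> of a rotation. In the sorted list of rotations, the prefixes change as often as there
  are new ones, and the last symbols change at the ends of the runs.
\<close>

lemma card_prefixes_bwt_rows_Suc:
  assumes k: "k < length w"
  shows "card (take (Suc k) ` set (bwt_rows w)) \<le> card (take k ` set (bwt_rows w)) + bwt_r w - 1"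
proof -
  let ?xs = "bwt_rows w"
  \<comment> \<open>The last symbol of a rotated row is the first symbol of the row, and
    \<open>k < length w\<close> keeps this symbol out of \<open>take k (rotate1 x)\<close>.\<close>
  have cons: "last (rotate1 x) # take k (rotate1 x) = take (Suc k) x" if "x \<in> set ?xs" for x
    using length_bwt_row[OF that] k by (cases x) auto
  have "take (Suc k) ` set ?xs = (\<lambda>x. last x # take k x) ` (rotate1 ` set ?xs)"
    using cons by (force simp: image_image)
  also have "rotate1 ` set ?xs = set ?xs" by (rule rotate1_bwt_rows[symmetric])
  also have "(\<lambda>x. last x # take k x) ` set ?xs =
      (\<lambda>(a, u). a # u) ` set (zip (bwt w) (map (take k) ?xs))"
    by (force simp: bwt_eq zip_map_map zip_same_conv_map image_image)
  finally have "card (take (Suc k) ` set ?xs) \<le> card (set (zip (bwt w) (map (take k) ?xs)))"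
    by (simp add: card_image_le)
  also have "\<dots> \<le> length (remdups_adj (zip (bwt w) (map (take k) ?xs)))"
    by (rule card_set_le_remdups_adj)
  also have "\<dots> \<le> bwt_r w + length (remdups_adj (map (take k) ?xs)) - 1"
    unfolding bwt_r_def by (rule length_remdups_adj_Pair) (simp add: bwt_eq)
  also have "sorted ?xs" by (simp add: bwt_rows_def)
  then have "sorted (map (take k) ?xs)"
    by (auto simp: sorted_map intro: sorted_wrt_mono_rel[rotated] take_mono_str)
  then have "length (remdups_adj (map (take k) ?xs)) = card (take k ` set ?xs)"
    by (simp add: length_remdups_adj_sorted)
  finally show ?thesis by (simp add: add.commute)
qed

lemma card_prefixes_bwt_rows:
  assumes "w \<noteq> []"
  shows "1 \<le> k \<Longrightarrow> k \<le> length w \<Longrightarrow> card (take k ` set (bwt_rows w)) \<le> bwt_r w * k"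
proof (induction k rule: nat_induct_at_least[of 1])
  case base
  have "card (take 0 ` set (bwt_rows w)) \<le> 1" by (simp add: image_constant_conv)
  then show ?case using card_prefixes_bwt_rows_Suc[of 0 w] assms by simp
next
  case (Suc k)
  then show ?case using card_prefixes_bwt_rows_Suc[of k w] by simp
qed

lemma delta_le_bwt_r:
  assumes "w \<noteq> []"
  shows "delta w \<le> real (bwt_r w)"
proof (rule delta_le[OF assms])
  fix k assume k: "1 \<le> k" "k \<le> length w"
  have "factors k w \<subseteq> take k ` set (bwt_rows w)"
  proof
    fix u assume "u \<in> factors k w"
    then obtain i where i: "i + k \<le> length w" "u = take k (drop i w)"
      unfolding factors_def sublist_iff_take_drop by auto
    then have "u = take k (rotate i w)" "i < length w"
      using k by (simp_all add: rotate_drop_take)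
    then show "u \<in> take k ` set (bwt_rows w)" by (auto simp: set_bwt_rows)
  qed
  then have "card (factors k w) \<le> card (take k ` set (bwt_rows w))" by (intro card_mono) auto
  also have "\<dots> \<le> bwt_r w * k" by (rule card_prefixes_bwt_rows[OF assms k])
  finally show "real (card (factors k w)) \<le> real (bwt_r w) * real k"
    by (metis of_nat_le_iff of_nat_mult)
qed

text \<open>Rotation by \<open>i + 1\<close> ends with the symbol of \<open>w\<close> at index
  \<open>i\<close>. The shift of the index does no harm because rotations by 0 and by
  \<open>length w\<close> agree.\<close>

lemma mset_bwt: "mset (bwt w) = mset w"
proof (cases "w = []")
  case False
  have last: "last (rotate (Suc i) w) = w ! i" if "i < length w" for i
  proof -
    have "rotate i w \<noteq> []" using False by simp
    then have "last (rotate1 (rotate i w)) = hd (rotate i w)" by (cases "rotate i w") auto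
    then show ?thesis using False that by (simp add: hd_rotate_conv_nth)
  qed
  have perm: "mset (map f [0..<n]) = mset (map (\<lambda>i. f (Suc i)) [0..<n])" if "f 0 = f n"
    for f :: "nat \<Rightarrow> nat" and n
  proof -
    have "add_mset (f n) (mset (map f [0..<n])) = mset (map f [0..<Suc n])" by simp
    also have "\<dots> = add_mset (f 0) (mset (map (\<lambda>i. f (Suc i)) [0..<n]))"
      by (simp only: map_upt_Suc mset.simps o_def)
    finally show ?thesis using that by simp
  qed
  have "mset (bwt w) = mset (map (\<lambda>i. last (rotate i w)) [0..<length w])"
    by (simp add: bwt_def multiset.map_comp o_def)
  also have "\<dots> = mset (map (\<lambda>i. last (rotate (Suc i) w)) [0..<length w])"
    by (rule perm) simp
  also have "map (\<lambda>i. last (rotate (Suc i) w)) [0..<length w] = map ((!) w) [0..<length w]"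
    using last by (intro map_cong) auto
  also have "\<dots> = w" by (rule map_nth)
  finally show ?thesis .
qed (simp add: bwt_def)

text \<open>Each symbol other than \<open>a\<close> accounts for at most its own run and a run of
  \<open>a\<close> right after it. Only an initial run of \<open>a\<close> is left over.\<close>

lemma length_remdups_adj_le_filter:
  "length (remdups_adj xs) \<le> 2 * length (filter (\<lambda>x. x \<noteq> a) xs) + (if xs \<noteq> [] \<and> hd xs = a then 1 else 0)"
  by (induction xs rule: remdups_adj.induct) (auto, blast)

text \<open>The transform permutes the symbols, so a word with few symbols other than
  \<open>a\<close> has few runs in whatever order its rotations are sorted.\<close>

lemma bwt_r_le: "bwt_r w \<le> 2 * length (filter (\<lambda>x. x \<noteq> a) w) + 1"
proof -
  have "length (filter (\<lambda>x. x \<noteq> a) (bwt w)) = length (filter (\<lambda>x. x \<noteq> a) w)"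
    by (metis mset_bwt mset_filter size_mset)
  then show ?thesis
    using length_remdups_adj_le_filter[of "bwt w" a] unfolding bwt_r_def by (simp split: if_splits)
qed

section \<open>L-systems between NU-systems and straight-line programs\<close>

section \<open>L-systems\<close>

lemma morph_Nil [simp]: "morph \<phi> [] = []"
  and morph_Cons [simp]: "morph \<phi> (a # u) = \<phi> a @ morph \<phi> u"
  and morph_append [simp]: "morph \<phi> (u @ v) = morph \<phi> u @ morph \<phi> v"
  by (simp_all add: morph_def)

lemma morph_pow_Nil [simp]: "(morph \<phi> ^^ k) [] = []"
  by (induction k) auto

lemma morph_pow_append: "(morph \<phi> ^^ k) (u @ v) = (morph \<phi> ^^ k) u @ (morph \<phi> ^^ k) v"
  by (induction k) auto

lemma morph_pow_eq_concat: "(morph \<phi> ^^ k) u = concat (map (\<lambda>a. (morph \<phi> ^^ k) [a]) u)"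
proof (induction u)
  case (Cons a u)
  then show ?case using morph_pow_append[of k \<phi> "[a]" u] by simp
qed simp

lemma length_ls_string: "lsystem C L \<Longrightarrow> length (ls_string L) = ls_length L"
  by (simp add: lsystem_def ls_string_def)

lemma explicit_lsystem:
  assumes "w \<noteq> []" "1 \<le> C"
  shows "\<exists>L. lsystem C L \<and> ls_string L = w \<and> ls_size L \<le> 3 * length w + 2"
proof -
  define L where "L = \<lparr>ls_alph = set w, ls_rule = (\<lambda>a. [a]), ls_coding = id, ls_axiom = w,
    ls_levels = 0, ls_length = length w\<rparr>"
  have "card (set w) \<le> length w" by (rule card_length)
  also have "\<dots> \<le> length w ^ C" using assms self_le_power[of "length w" C] by (simp add: Suc_le_eq)
  finally have "lsystem C L" using assms by (simp add: lsystem_def L_def Suc_le_eq)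
  moreover have "ls_string L = w" by (simp add: ls_string_def L_def)
  moreover have "ls_size L \<le> 3 * length w + 2"
    using card_length[of w] by (simp add: ls_size_def L_def)
  ultimately show ?thesis by blast
qed

lemma ell_le: "lsystem C L \<Longrightarrow> ell C (ls_string L) \<le> ls_size L"
  unfolding ell_def by (rule Inf_nat_lower) blast

lemma ell_attained:
  assumes "w \<noteq> []" "1 \<le> C"
  obtains L where "lsystem C L" "ls_string L = w" "ell C w = ls_size L"
proof -
  have "ell C w \<in> {ls_size L | L. lsystem C L \<and> ls_string L = w}"
    unfolding ell_def using explicit_lsystem[OF assms] by (intro Inf_nat_def1) blast
  with that show ?thesis by blast
qed

lemma lsystem_mono:
  assumes "lsystem C L" "C \<le> C'"
  shows "lsystem C' L"
proof -
  have "ls_length L ^ C \<le> ls_length L ^ C'"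
    using assms by (intro power_increasing) (auto simp: lsystem_def)
  then show ?thesis using assms(1) by (auto simp: lsystem_def)
qed

text \<open>A larger exponent admits more systems. Read backwards, a lower bound proved for exponent
  \<open>C'\<close> holds for every smaller \<open>C\<close>, which lets one family serve all
  exponents.\<close>

lemma ell_antimono:
  assumes "w \<noteq> []" "1 \<le> C" "C \<le> C'"
  shows "ell C' w \<le> ell C w"
proof -
  obtain L where "lsystem C L" "ls_string L = w" "ell C w = ls_size L"
    using ell_attained[OF assms(1,2)] by blast
  then show ?thesis using lsystem_mono[OF _ assms(3)] ell_le by metis
qed

subsection \<open>Simulation of L-systems by NU-systems\<close>

lemma nth_concat_split:
  assumes "p < length (concat xs)"
  shows "\<exists>m<length xs. \<exists>q<length (xs ! m).
    p = length (concat (take m xs)) + q \<and> concat xs ! p = xs ! m ! q"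
  using assms
proof (induction xs arbitrary: p)
  case (Cons x xs)
  show ?case
  proof (cases "p < length x")
    case True
    then show ?thesis by (intro exI[of _ 0]) (auto simp: nth_append)
  next
    case False
    then obtain p' where p': "p = length x + p'" using le_Suc_ex linorder_not_le by blast
    then have "p' < length (concat xs)" using Cons.prems by simp
    from Cons.IH[OF this] obtain m q where "m < length xs" "q < length (xs ! m)"
      "p' = length (concat (take m xs)) + q" "concat xs ! p' = xs ! m ! q" by blast
    then show ?thesis using p' by (intro exI[of _ "Suc m"] conjI exI[of _ q]) (auto simp: nth_append)
  qed
qed simp

lemma sum_list_map_Sym: "nu_widths (map Sym us) = length us" "nu_syms_size (map Sym us) = length us"
  by (induction us) auto

text \<open>Without extraction symbols the levels are the iterates of the morphism.
  \<open>nth_concat_split\<close> finds the symbol whose image covers a given position, as the rule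
  \<open>level\<close> demands; \<open>Suc p\<close> turns a list index into a position.\<close>

lemma nu_at_Sym:
  assumes rule: "\<And>a. nu_rule N a = map Sym (\<phi> a)"
  shows "p < length ((morph \<phi> ^^ k) us) \<Longrightarrow> nu_at N (map Sym us) k (Suc p) ((morph \<phi> ^^ k) us ! p)"
proof (induction k arbitrary: p)
  case 0
  then have "map Sym us = map Sym (take p us) @ Sym (us ! p) # map Sym (drop (Suc p) us)"
    by (simp add: id_take_nth_drop[of p us, symmetric] flip: list.map map_append)
  moreover have "nu_widths (map Sym (take p us)) + 1 = Suc p"
    using 0 unfolding sum_list_map_Sym by simp
  ultimately show ?case using nu_at.sym by (metis funpow_0)
next
  case (Suc k)
  let ?v = "(morph \<phi> ^^ k) us"
  have step: "(morph \<phi> ^^ Suc k) us = concat (map \<phi> ?v)" by (simp add: morph_def[of \<phi> ?v])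
  have p: "p < length (concat (map \<phi> ?v))" using Suc.prems by (simp only: step)
  obtain m q where m: "m < length (map \<phi> ?v)" and q: "q < length (map \<phi> ?v ! m)"
    and p_eq: "p = length (concat (take m (map \<phi> ?v))) + q"
    and val: "concat (map \<phi> ?v) ! p = map \<phi> ?v ! m ! q"
    using nth_concat_split[OF p] by blast
  let ?b = "?v ! m"
  have mv: "m < length ?v" using m by simp
  have base: "nu_at N (nu_rule N ?b) 0 (Suc q) (\<phi> ?b ! q)"
  proof -
    have "q < length (\<phi> ?b)" using q mv by simp
    then have "map Sym (\<phi> ?b) = map Sym (take q (\<phi> ?b)) @ Sym (\<phi> ?b ! q) # map Sym (drop (Suc q) (\<phi> ?b))"
      by (simp add: id_take_nth_drop[of q "\<phi> ?b", symmetric] flip: list.map map_append)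
    moreover have "nu_widths (map Sym (take q (\<phi> ?b))) + 1 = Suc q"
      using \<open>q < length (\<phi> ?b)\<close> unfolding sum_list_map_Sym by simp
    ultimately show ?thesis using nu_at.sym rule by metis
  qed
  have "nu_at N (map Sym us) (Suc k)
     (nu_widths (concat (map (nu_rule N) (take m ?v))) + Suc q) (\<phi> ?b ! q)"
  proof (rule nu_at.level[OF _ _ base])
    show "\<forall>i<length (take m ?v). nu_at N (map Sym us) k (i + 1) (take m ?v ! i)"
      using Suc.IH mv by simp
    show "nu_at N (map Sym us) k (length (take m ?v) + 1) ?b"
      using Suc.IH[OF mv] mv by simp
  qed
  moreover have "nu_rule N = (\<lambda>a. map Sym (\<phi> a))" by (simp add: fun_eq_iff rule)
  then have "concat (map (nu_rule N) (take m ?v)) = map Sym (concat (map \<phi> (take m ?v)))"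
    by (simp add: map_concat o_def)
  ultimately have "nu_at N (map Sym us) (Suc k) (length (concat (map \<phi> (take m ?v))) + Suc q) (\<phi> ?b ! q)"
    by (simp only: sum_list_map_Sym)
  moreover have "length (concat (map \<phi> (take m ?v))) + Suc q = Suc p" using p_eq by (simp add: take_map)
  moreover have "(morph \<phi> ^^ Suc k) us ! p = \<phi> ?b ! q" using val mv by (simp only: step nth_map)
  ultimately show ?case by metis
qed

lemma nu_le_ell:
  assumes "w \<noteq> []" "1 \<le> C"
  shows "nu C w \<le> ell C w"
proof -
  obtain L where L: "lsystem C L" "ls_string L = w" "ell C w = ls_size L"
    using ell_attained[OF assms] by blast
  define N where "N = \<lparr>nu_alph = ls_alph L, nu_rule = (\<lambda>a. map Sym (ls_rule L a)),
    nu_coding = ls_coding L, nu_axiom = map Sym (ls_axiom L), nu_levels = ls_levels L,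
    nu_length = ls_length L\<rparr>"
  let ?u = "(morph (ls_rule L) ^^ ls_levels L) (ls_axiom L)"
  have N: "nusystem C N"
    using L(1) by (auto simp: nusystem_def lsystem_def N_def nu_sym_ok_def)
  have len: "length w = ls_length L" using length_ls_string[OF L(1)] L(2) by simp
  have lu: "ls_length L \<le> length ?u" using L(1) by (simp add: lsystem_def)
  have "nu_generates N w"
    unfolding nu_generates_def
  proof (intro conjI ballI)
    show "length w = nu_length N" using len by (simp add: N_def)
    fix p assume "p \<in> {1..length w}"
    then obtain p' where p': "p = Suc p'" "p' < length w" by (cases p) auto
    have "nu_at N (map Sym (ls_axiom L)) (ls_levels L) (Suc p') (?u ! p')"
      using p' len lu by (intro nu_at_Sym) (auto simp: N_def)
    moreover have "w ! p' = ls_coding L (?u ! p')"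
      using p' len lu unfolding L(2)[symmetric] ls_string_def by simp
    ultimately show "\<exists>c. nu_at N (nu_axiom N) (nu_levels N) p c \<and> w ! (p - 1) = nu_coding N c"
      using p' by (auto simp: N_def)
  qed
  then have "nu C w \<le> nu_size N" unfolding nu_def using N by (intro Inf_nat_lower) blast
  also have "nu_size N = ls_size L"
    by (simp only: nu_size_def ls_size_def N_def nusystem.simps sum_list_map_Sym)
  finally show ?thesis using L(3) by simp
qed

subsection \<open>Simulation of straight-line programs by L-systems\<close>

text \<open>
  The layers grow strictly until they are stable, so as many rewriting steps as there are variables
  expand every variable that derives a string.
\<close>

primrec slp_layer :: "grammar \<Rightarrow> nat \<Rightarrow> nat set" where
  "slp_layer G 0 = {}"
| "slp_layer G (Suc k) = {A \<in> gr_vars G. \<forall>B. Var B \<in> rhs_syms (gr_rule G A) \<longrightarrow> B \<in> slp_layer G k}"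

lemma slp_layer_mono_Suc: "slp_layer G k \<subseteq> slp_layer G (Suc k)"
  by (induction k) auto

lemma slp_layer_card:
  assumes "finite (gr_vars G)"
  shows "slp_layer G (card (gr_vars G)) = (\<Union>k. slp_layer G k)"
proof (rule finite_mono_strict_prefix_implies_finite_fixpoint)
  show sub: "slp_layer G k \<subseteq> gr_vars G" for k by (cases k) auto
  show "finite (gr_vars G)" by fact
  show "\<exists>N. (\<forall>n\<le>N. \<forall>m\<le>N. m < n \<longrightarrow> slp_layer G m \<subset> slp_layer G n) \<and>
      (\<forall>n\<ge>N. slp_layer G N = slp_layer G n)"
  proof (rule finite_mono_remains_stable_implies_strict_prefix)
    show "finite (range (slp_layer G))"
    proof (rule finite_subset)
      show "range (slp_layer G) \<subseteq> Pow (gr_vars G)" using sub by blast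
    qed (simp add: assms)
    show "mono (slp_layer G)"
      using slp_layer_mono_Suc by (rule incseq_SucI)
    show "\<forall>n. slp_layer G n = slp_layer G (Suc n) \<longrightarrow> slp_layer G (Suc n) = slp_layer G (Suc (Suc n))"
      by auto
  qed
qed

lemma derives_in_slp_layer:
  assumes "slp G" "derives G X u"
  shows "\<exists>k. \<forall>A. X = Var A \<longrightarrow> A \<in> slp_layer G k"
  using assms(2)
proof (induction rule: derives.induct)
  case (terminal a)
  then show ?case by simp
next
  case (seq A Xs us)
  have layer_mono: "slp_layer G i \<subseteq> slp_layer G j" if "i \<le> j" for i j
    using slp_layer_mono_Suc that by (rule lift_Suc_mono_le)
  have "\<exists>k. \<forall>B. X = Var B \<longrightarrow> B \<in> slp_layer G k" if "X \<in> set Xs" for X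
    using seq(3) that by (auto simp: list_all2_conv_all_nth in_set_conv_nth)
  then obtain h where h: "\<And>B. Var B \<in> set Xs \<Longrightarrow> B \<in> slp_layer G (h (Var B))" by metis
  have "B \<in> slp_layer G (Max (h ` set Xs))" if "Var B \<in> set Xs" for B
    using h[OF that] layer_mono[of "h (Var B)" "Max (h ` set Xs)"] that by auto
  then have "A \<in> slp_layer G (Suc (Max (h ` set Xs)))" using seq(1,2) by simp
  then show ?case by blast
qed (use assms(1) in \<open>fastforce simp: slp_def\<close>)+

text \<open>Variables become letters above a bound \<open>M\<close> of all terminals and are
  rewritten in parallel, while terminals are fixed by the morphism.\<close>

lemma ell_le_slp_g:
  assumes w: "w \<noteq> []" and C: "1 \<le> C"
  shows "ell C w \<le> 8 * slp_g w"
proof -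
  obtain G where G: "slp G" "gr_generates G w" "slp_g w = gr_size G"
    using slp_g_attained[OF w] by blast
  let ?V = "gr_vars G" and ?r = "gr_rule G"
  define T where "T = {a. \<exists>A\<in>?V. Term a \<in> rhs_syms (?r A)}"
  have fin: "finite ?V" and start: "gr_start G \<in> ?V"
    and ok: "\<And>A. A \<in> ?V \<Longrightarrow> rhs_ok G (?r A)"
    and Seq: "\<And>A. A \<in> ?V \<Longrightarrow> \<exists>Xs. ?r A = Seq Xs"
    using G(1) by (auto simp: slp_def collage_system_def)
  have T_eq: "(\<lambda>a. [a]) ` T = (\<Union>A\<in>?V. {[a] | a. Term a \<in> rhs_syms (?r A)})"
    by (auto simp: T_def)
  have finT: "finite T"
  proof -
    have "finite ((\<lambda>a. [a]) ` T)" unfolding T_eq using fin card_rhs_terminals(2) by auto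
    then show ?thesis by (rule finite_imageD) (auto simp: inj_on_def)
  qed
  have cardT: "card T \<le> gr_size G"
  proof -
    have "card T = card ((\<lambda>a. [a]) ` T)" by (rule card_image[symmetric]) (auto simp: inj_on_def)
    also have "\<dots> \<le> (\<Sum>A\<in>?V. card {[a] | a. Term a \<in> rhs_syms (?r A)})"
      unfolding T_eq by (rule card_UN_le[OF fin])
    also have "\<dots> \<le> gr_size G" unfolding gr_size_def by (intro sum_mono card_rhs_terminals)
    finally show ?thesis .
  qed
  have pos: "1 \<le> rhs_size (?r A)" if "A \<in> ?V" for A
    using ok[OF that] Seq[OF that] by (auto simp: Suc_le_eq)
  have cardV: "card ?V \<le> gr_size G"
    unfolding gr_size_def using sum_mono[of ?V "\<lambda>_. 1" "\<lambda>A. rhs_size (?r A)"] pos by simp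
  have g1: "1 \<le> gr_size G"
    using cardV start fin by (metis One_nat_def Suc_leI card_gt_0_iff empty_iff le_trans)
  show ?thesis
  \<comment> \<open>The alphabet and the number of levels must stay polynomial in the length. If the
    grammar has more symbols than the word, then \<open>length w < 2 * gr_size G\<close> and the
    explicit system, of size at most \<open>3 * length w + 2\<close>, is good enough; this case
    gives the constant 8.\<close>
  proof (cases "card T + card ?V \<le> length w")
    case False
    obtain L where "lsystem C L" "ls_string L = w" "ls_size L \<le> 3 * length w + 2"
      using explicit_lsystem[OF w C] by blast
    then have "ell C w \<le> 3 * length w + 2" using ell_le order_trans by blast
    then show ?thesis using False cardT cardV g1 G(3) by linarith
  next
    case True
    obtain M where M: "\<And>a. a \<in> T \<Longrightarrow> a < M"
      using finT unfolding finite_nat_set_iff_bounded by blast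
    define enc where "enc X = (case X of Term a \<Rightarrow> a | Var A \<Rightarrow> M + A)" for X
    define \<phi> where "\<phi> a = (if a < M then [a] else
      (case ?r (a - M) of Seq Xs \<Rightarrow> map enc Xs | _ \<Rightarrow> [a]))" for a
    define L where "L = \<lparr>ls_alph = T \<union> (+) M ` ?V, ls_rule = \<phi>, ls_coding = id,
      ls_axiom = [M + gr_start G], ls_levels = card ?V, ls_length = length w\<rparr>"
    have enc_simps [simp]: "enc (Term a) = a" "enc (Var A) = M + A" for a A
      by (simp_all add: enc_def)
    have \<phi>_T: "\<phi> a = [a]" if "a \<in> T" for a using M[OF that] by (simp add: \<phi>_def)
    have \<phi>_V: "\<phi> (M + A) = map enc Xs" if "?r A = Seq Xs" for A Xs
      using that by (simp add: \<phi>_def)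
    have pow_T: "(morph \<phi> ^^ k) [a] = [a]" if "a \<in> T" for k a
      by (induction k) (simp_all add: \<phi>_T[OF that])
    \<comment> \<open>Branches of the derivation have different depths. Since terminals are fixed,
      further steps leave a finished branch unchanged, so one number of levels suits all
      branches.\<close>
    have expand: "(morph \<phi> ^^ k) [M + A] = u" if "A \<in> slp_layer G k" "derives G (Var A) u" for k A u
      using that
    proof (induction k arbitrary: A u)
      case (Suc k)
      have A: "A \<in> ?V" using Suc.prems(1) by simp
      then obtain Xs where Xs: "?r A = Seq Xs" using Seq by blast
      obtain us where us: "u = concat us" "list_all2 (derives G) Xs us"
        by (rule derives_SeqE[OF Suc.prems(2) Xs])
      have "(morph \<phi> ^^ k) [enc X] = v" if "X \<in> set Xs" "derives G X v" for X v
      proof (cases X)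
        case (Term a)
        then have "a \<in> T" using that(1) A Xs by (auto simp: T_def intro!: bexI[of _ A])
        then show ?thesis using pow_T that(2) Term by (simp add: derives_Term)
      next
        case (Var B)
        then show ?thesis using Suc.IH[of B v] Suc.prems(1) that Xs by simp
      qed
      then have "list_all2 (\<lambda>X v. (morph \<phi> ^^ k) [enc X] = v) Xs us"
        using us(2) by (auto simp: list_all2_conv_all_nth)
      then have *: "map (\<lambda>X. (morph \<phi> ^^ k) [enc X]) Xs = us"
        by (auto simp: list_all2_conv_all_nth intro: nth_equalityI)
      have "(morph \<phi> ^^ Suc k) [M + A] = (morph \<phi> ^^ k) (map enc Xs)"
        by (simp add: funpow_Suc_right \<phi>_V[OF Xs] del: funpow.simps)
      also have "\<dots> = concat (map (\<lambda>X. (morph \<phi> ^^ k) [enc X]) Xs)"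
        by (subst morph_pow_eq_concat) (simp add: o_def)
      finally show ?case using * us(1) by simp
    qed simp
    have w_eq: "(morph \<phi> ^^ card ?V) [M + gr_start G] = w"
    proof (rule expand)
      show d: "derives G (Var (gr_start G)) w" using G(2) by (simp add: gr_generates_def)
      show "gr_start G \<in> slp_layer G (card ?V)"
        using derives_in_slp_layer[OF G(1) d] slp_layer_card[OF fin] by auto
    qed
    have inj: "inj_on ((+) M) ?V" by (simp add: inj_on_def)
    have disj: "T \<inter> (+) M ` ?V = {}" using M by fastforce
    have card_alph: "card (T \<union> (+) M ` ?V) = card T + card ?V"
      using finT fin disj inj by (simp add: card_Un_disjoint card_image)
    have n: "length w \<le> length w ^ C"
      using w C self_le_power[of "length w" C] by (simp add: Suc_le_eq)
    have alph: "\<phi> a \<noteq> [] \<and> set (\<phi> a) \<subseteq> T \<union> (+) M ` ?V" if a: "a \<in> T \<union> (+) M ` ?V" for a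
    proof (cases "a \<in> T")
      case True
      then show ?thesis by (simp add: \<phi>_T)
    next
      case False
      then obtain A where A: "A \<in> ?V" "a = M + A" using a by auto
      then obtain Xs where Xs: "?r A = Seq Xs" using Seq by blast
      have ok': "Xs \<noteq> []" "\<And>X. X \<in> set Xs \<Longrightarrow> gsym_ok G X" using ok[OF A(1)] Xs by auto
      have "enc X \<in> T \<union> (+) M ` ?V" if X: "X \<in> set Xs" for X
      proof (cases X)
        case (Term b)
        then have "b \<in> T" using X A Xs by (auto simp: T_def intro!: bexI[of _ A])
        then show ?thesis using Term by simp
      next
        case (Var B)
        then show ?thesis using ok'(2)[OF X] by simp
      qed
      then show ?thesis using A \<phi>_V[OF Xs] ok'(1) by auto
    qed
    have "lsystem C L"
      unfolding lsystem_def L_def using alph start w w_eq n True finT fin card_alph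
      by (simp add: Suc_le_eq)
    moreover have "ls_string L = w" by (simp add: ls_string_def L_def w_eq)
    ultimately have "ell C w \<le> ls_size L" using ell_le by blast
    also have "ls_size L = (\<Sum>a\<in>T. length (\<phi> a)) + (\<Sum>A\<in>?V. length (\<phi> (M + A))) + 1 + (card T + card ?V) + 2"
      unfolding ls_size_def L_def using finT fin disj inj card_alph
      by (simp add: sum.union_disjoint sum.reindex)
    also have "(\<Sum>a\<in>T. length (\<phi> a)) = card T" by (simp add: \<phi>_T)
    also have "(\<Sum>A\<in>?V. length (\<phi> (M + A))) = gr_size G"
      unfolding gr_size_def
    proof (rule sum.cong[OF refl])
      fix A assume "A \<in> ?V"
      then obtain Xs where "?r A = Seq Xs" using Seq by blast
      then show "length (\<phi> (M + A)) = rhs_size (?r A)" by (simp add: \<phi>_V)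
    qed
    finally show ?thesis using cardT cardV g1 G(3) by linarith
  qed
qed

section \<open>Block words, on which all ten measures are small\<close>

lemma replicate_Cons_eq_iff:
  assumes "a \<noteq> b"
  shows "replicate i a @ b # xs = replicate j a @ b # ys \<longleftrightarrow> i = j \<and> xs = ys"
proof (induction i arbitrary: j)
  case 0
  then show ?case using assms by (cases j) auto
next
  case (Suc i)
  then show ?case using assms by (cases j) auto
qed

section \<open>Strings with few runs\<close>

definition blocks_word :: "nat list \<Rightarrow> str" where
  "blocks_word es = concat (map (\<lambda>e. replicate e 0 @ [1]) es)"

lemma blocks_word_simps [simp]:
  "blocks_word [] = []" "blocks_word (e # es) = replicate e 0 @ 1 # blocks_word es"
  by (simp_all add: blocks_word_def)

lemma set_blocks_word: "set (blocks_word es) \<subseteq> {0, 1}"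
  by (induction es) auto

lemma blocks_word_eq_Nil_iff [simp]: "blocks_word es = [] \<longleftrightarrow> es = []"
  by (cases es) auto

lemma inj_blocks_word: "inj blocks_word"
proof (rule injI)
  show "blocks_word es = blocks_word es' \<Longrightarrow> es = es'" for es es'
  proof (induction es arbitrary: es')
    case (Cons e es)
    then obtain e' es'' where es': "es' = e' # es''" by (cases es') auto
    then have "e = e' \<and> blocks_word es = blocks_word es''"
      using Cons.prems replicate_Cons_eq_iff[of "0::nat" 1 e _ e'] by simp
    then show ?case using Cons.IH es' by simp
  qed (metis blocks_word_eq_Nil_iff)
qed

lemma length_filter_blocks_word: "length (filter (\<lambda>a. a \<noteq> 0) (blocks_word es)) = length es"
  by (induction es) auto

lemma bwt_r_blocks_word: "bwt_r (blocks_word es) \<le> 2 * length es + 1"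
  using bwt_r_le[of "blocks_word es" 0] by (simp only: length_filter_blocks_word)

text \<open>One start rule of length 2 per block, and one run rule of size 2 per block. Run rules
  need an exponent above 1, whence the lower bound on the entries.\<close>

lemma rlslp_g_blocks_word:
  assumes ge2: "\<And>e. e \<in> set es \<Longrightarrow> 2 \<le> e" and ne: "es \<noteq> []"
  shows "rlslp_g (blocks_word es) \<le> 4 * length es"
proof -
  let ?m = "length es"
  define G where "G = \<lparr>gr_vars = {..?m}, gr_rule = (\<lambda>A. case A of
      0 \<Rightarrow> Seq (concat (map (\<lambda>i. [Var (Suc i), Term 1]) [0..<?m]))
    | Suc i \<Rightarrow> Run (Term 0) (es ! i)), gr_start = 0\<rparr>"
  have run: "derives G (Var (Suc i)) (replicate (es ! i) 0)" if "i < ?m" for i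
  proof -
    have "derives G (Var (Suc i)) (concat (replicate (es ! i) [0]))"
      using that by (intro derives.run) (auto simp: G_def derives_Term)
    moreover have "concat (replicate k [0]) = replicate k (0::nat)" for k by (induction k) auto
    ultimately show ?thesis by simp
  qed
  have list: "list_all2 (derives G) (concat (map (\<lambda>i. [Var (Suc i), Term 1]) js))
      (concat (map (\<lambda>i. [replicate (es ! i) 0, [1]]) js))" if "set js \<subseteq> {..<?m}" for js
    using that run by (induction js) (auto simp: derives_Term)
  have "derives G (Var 0) (concat (concat (map (\<lambda>i. [replicate (es ! i) 0, [1]]) [0..<?m])))"
  proof (rule derives.seq)
    show "0 \<in> gr_vars G" "gr_rule G 0 = Seq (concat (map (\<lambda>i. [Var (Suc i), Term 1]) [0..<?m]))"
      by (simp_all add: G_def)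
  qed (rule list, auto)
  also have "concat (concat (map (\<lambda>i. [replicate (es ! i) 0, [1]]) js)) =
      concat (map (\<lambda>i. replicate (es ! i) 0 @ [1]) js)" for js
    by (induction js) auto
  also have "map (\<lambda>i. replicate (es ! i) 0 @ [1]) [0..<?m] = map (\<lambda>e. replicate e 0 @ [1]) es"
    by (rule nth_equalityI) auto
  finally have "gr_generates G (blocks_word es)"
    by (simp add: gr_generates_def blocks_word_def G_def)
  moreover have "Suc 0 < es ! i" if "i < ?m" for i using ge2[OF nth_mem[OF that]] by simp
  then have "rlslp G"
    using ne by (auto simp: rlslp_def collage_system_def G_def Suc_le_eq split: nat.split)
  ultimately have "rlslp_g (blocks_word es) \<le> gr_size G" by (rule rlslp_g_le[rotated])
  also have "gr_size G = 2 * ?m + 2 * ?m"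
  proof -
    have "length (concat (map (\<lambda>i. [Var (Suc i), Term 1]) js)) = 2 * length js" for js
      by (induction js) auto
    then show ?thesis by (simp add: gr_size_def G_def sum.atMost_shift)
  qed
  finally show ?thesis by simp
qed

subsection \<open>Macro-schemes\<close>

lemma phrase_start_append: "t \<le> length B \<Longrightarrow> phrase_start (B @ X) t = phrase_start B t"
  by (simp add: phrase_start_def)

lemma recoverable_append: "recoverable B p \<Longrightarrow> recoverable (B @ X) p"
proof (induction rule: recoverable.induct)
  case (explicit t)
  then show ?case
    using recoverable.explicit[of t "B @ X"] by (simp add: phrase_start_append nth_append)
next
  case (copied t l q m)
  then show ?case
    using recoverable.copied[of t "B @ X" l q m] by (simp add: phrase_start_append nth_append)
qed

lemma substr_append: "1 \<le> i \<Longrightarrow> j \<le> length w \<Longrightarrow> substr (w @ v) i j = substr w i j"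
  by (auto simp: substr_def)

lemma macro_scheme_phrase_append:
  assumes "macro_scheme w B" "t < length B"
  shows "case (B @ X) ! t of (l, None) \<Rightarrow> l = 1
      | (l, Some q) \<Rightarrow> l \<ge> 1 \<and> q \<ge> 1 \<and> q + l - 1 \<le> length (w @ v) \<and> q \<noteq> phrase_start (B @ X) t \<and>
          substr (w @ v) q (q + l - 1) =
          substr (w @ v) (phrase_start (B @ X) t) (phrase_start (B @ X) t + l - 1)"
proof -
  have ph: "case B ! t of (l, None) \<Rightarrow> l = 1
      | (l, Some q) \<Rightarrow> l \<ge> 1 \<and> q \<ge> 1 \<and> q + l - 1 \<le> length w \<and> q \<noteq> phrase_start B t \<and>
          substr w q (q + l - 1) = substr w (phrase_start B t) (phrase_start B t + l - 1)"
    using assms unfolding macro_scheme_def by (elim conjE) (erule allE[of _ t], erule mp)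
  have "phrase_start B (Suc t) \<le> Suc (length w)"
    using phrase_start_le[of "Suc t" B] assms by (simp add: macro_scheme_def)
  then have "phrase_start B t + fst (B ! t) \<le> Suc (length w)"
    using phrase_start_Suc[OF assms(2)] by simp
  moreover have "1 \<le> phrase_start B t" by (simp add: phrase_start_def)
  ultimately show ?thesis
    using ph assms(2)
    by (auto simp: nth_append phrase_start_append substr_append split: option.splits prod.splits)
qed

lemma macro_scheme_snoc_explicit:
  assumes "macro_scheme w B"
  shows "macro_scheme (w @ [c]) (B @ [(1, None)])"
  unfolding macro_scheme_def
proof (intro conjI allI impI ballI)
  have sum: "sum_list (map fst B) = length w" using assms by (simp add: macro_scheme_def)
  then show "sum_list (map fst (B @ [(1, None)])) = length (w @ [c])" by simp
  have new: "phrase_start (B @ [(1, None)]) (length B) = Suc (length w)"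
    using sum by (simp add: phrase_start_def)
  fix t assume t: "t < length (B @ [(1::nat, None :: nat option)])"
  show "case (B @ [(1, None)]) ! t of (l, None) \<Rightarrow> l = 1
      | (l, Some q) \<Rightarrow> l \<ge> 1 \<and> q \<ge> 1 \<and> q + l - 1 \<le> length (w @ [c]) \<and>
          q \<noteq> phrase_start (B @ [(1, None)]) t \<and>
          substr (w @ [c]) q (q + l - 1) = substr (w @ [c]) (phrase_start (B @ [(1, None)]) t)
            (phrase_start (B @ [(1, None)]) t + l - 1)"
  proof (cases "t < length B")
    case True
    then show ?thesis by (rule macro_scheme_phrase_append[OF assms])
  next
    case False
    then show ?thesis using t by (auto simp: nth_append)
  qed
next
  fix p assume p: "p \<in> {1..length (w @ [c])}"
  have sum: "sum_list (map fst B) = length w" using assms by (simp add: macro_scheme_def)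
  show "recoverable (B @ [(1, None)]) p"
  proof (cases "p \<le> length w")
    case True
    then show ?thesis using assms p by (intro recoverable_append) (simp add: macro_scheme_def)
  next
    case False
    then have "p = phrase_start (B @ [(1, None)]) (length B)"
      using p sum by (simp add: phrase_start_def)
    then show ?thesis using recoverable.explicit[of "length B" "B @ [(1, None)]"] by simp
  qed
qed

text \<open>The new phrase copies from the position just before itself. Source and phrase overlap,
  but every position points to its predecessor, so recovery reaches the \<open>c\<close> that is
  already there.\<close>

lemma macro_scheme_snoc_run:
  assumes B: "macro_scheme (w @ [c]) B" and m: "1 \<le> m"
  shows "macro_scheme (w @ replicate (Suc m) c) (B @ [(m, Some (Suc (length w)))])"
proof -
  let ?X = "[(m, Some (Suc (length w)))]" and ?w = "(w @ [c]) @ replicate m c"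
  let ?s = "Suc (Suc (length w))"
  have sum: "sum_list (map fst B) = Suc (length w)" using B by (simp add: macro_scheme_def)
  then have new: "phrase_start (B @ ?X) (length B) = ?s" by (simp add: phrase_start_def)
  have sub: "substr ?w (Suc (length w)) (Suc (length w) + m - 1) = substr ?w ?s (?s + m - 1)"
  proof -
    have "take m (c # replicate m c) = replicate m c"
      using take_replicate[of m "Suc m" c] by (simp add: min_def)
    then show ?thesis using m by (simp add: substr_def)
  qed
  have "macro_scheme ?w (B @ ?X)"
    unfolding macro_scheme_def
  proof (intro conjI allI impI ballI)
    show "sum_list (map fst (B @ ?X)) = length ?w" using sum by simp
    fix t assume t: "t < length (B @ ?X)"
    show "case (B @ ?X) ! t of (l, None) \<Rightarrow> l = 1
      | (l, Some q) \<Rightarrow> l \<ge> 1 \<and> q \<ge> 1 \<and> q + l - 1 \<le> length ?w \<and> q \<noteq> phrase_start (B @ ?X) t \<and>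
          substr ?w q (q + l - 1) =
          substr ?w (phrase_start (B @ ?X) t) (phrase_start (B @ ?X) t + l - 1)"
    proof (cases "t < length B")
      case True
      then show ?thesis by (rule macro_scheme_phrase_append[OF B])
    next
      case False
      then have "t = length B" using t by simp
      moreover have "(B @ ?X) ! length B = (m, Some (Suc (length w)))" by simp
      ultimately show ?thesis using new sub m by (simp del: append_assoc)
    qed
  next
    fix p assume p: "p \<in> {1..length ?w}"
    have old: "recoverable (B @ ?X) p" if "1 \<le> p" "p \<le> Suc (length w)" for p
      using B that by (intro recoverable_append) (simp add: macro_scheme_def)
    have "recoverable (B @ ?X) (?s + k)" if "k < m" for k
      using that
    proof (induction k)
      case 0
      then show ?case using recoverable.copied[of "length B" "B @ ?X" m "Suc (length w)" 0] old[of "Suc (length w)"] new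
        by simp
    next
      case (Suc k)
      then show ?case
        using recoverable.copied[of "length B" "B @ ?X" m "Suc (length w)" "Suc k"] new by simp
    qed
    note new_rec = this
    show "recoverable (B @ ?X) p"
    proof (cases "p \<le> Suc (length w)")
      case True
      then show ?thesis using old p by simp
    next
      case False
      then have "?s + (p - ?s) = p" "p - ?s < m" using p m by auto
      then show ?thesis using new_rec by metis
    qed
  qed
  then show ?thesis by simp
qed

text \<open>Three phrases per block: an explicit 0, a self-overlapping copy for the other 0s, and an
  explicit 1. An entry of at least 2 makes the copy non-empty.\<close>

lemma bms_blocks_word:
  assumes "\<And>e. e \<in> set es \<Longrightarrow> 2 \<le> e"
  shows "bms (blocks_word es) \<le> 3 * length es"
proof -
  have "\<exists>B. macro_scheme (blocks_word es) B \<and> length B = 3 * length es"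
    using assms
  proof (induction es rule: rev_induct)
    case Nil
    then show ?case by (intro exI[of _ "[]"]) (simp add: macro_scheme_def)
  next
    case (snoc e es)
    then obtain B where B: "macro_scheme (blocks_word es) B" "length B = 3 * length es" by auto
    let ?w = "blocks_word es"
    obtain m where m: "e = Suc m" "1 \<le> m" using snoc.prems[of e] by (cases e) auto
    have "macro_scheme ((?w @ replicate (Suc m) 0) @ [1])
        (((B @ [(1, None)]) @ [(m, Some (Suc (length ?w)))]) @ [(1, None)])"
      by (intro macro_scheme_snoc_explicit macro_scheme_snoc_run B m)
    moreover have "(?w @ replicate (Suc m) 0) @ [1] = blocks_word (es @ [e])"
      by (simp add: blocks_word_def m)
    ultimately show ?case using B(2)
      by (intro exI[of _ "((B @ [(1, None)]) @ [(m, Some (Suc (length ?w)))]) @ [(1, None)]"]) simp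
  qed
  then show ?thesis using bms_le by metis
qed

subsection \<open>Parsings\<close>

text \<open>Checkpoints for \<open>length_parse_le_card\<close>: for each non-zero symbol at index
  \<open>j\<close>, the parsed text may end just before it, just after it, or one symbol later. The
  inserted 1 takes the last role for the first run, which no such symbol precedes.\<close>

definition block_ends :: "str \<Rightarrow> nat set" where
  "block_ends w = (let Q = {j. j < length w \<and> w ! j \<noteq> 0} in
     insert 1 (Suc ` Q \<union> Q \<union> (\<lambda>j. j + 2) ` Q))"

lemma block_ends_intros:
  assumes "j < length w" "w ! j \<noteq> 0"
  shows "Suc j \<in> block_ends w" "j \<in> block_ends w" "j + 2 \<in> block_ends w"
  using assms by (auto simp: block_ends_def Let_def)

lemma finite_block_ends: "finite (block_ends w)"
  by (simp add: block_ends_def Let_def)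

lemma card_block_ends: "card (block_ends (blocks_word es)) \<le> 3 * length es + 1"
proof -
  let ?w = "blocks_word es"
  define P where "P = {j. j < length ?w \<and> ?w ! j \<noteq> 0}"
  have fin: "finite P" by (simp add: P_def)
  have P: "card P = length es"
    unfolding P_def using length_filter_blocks_word[of es] by (simp only: length_filter_conv_card)
  have "card (insert 1 (Suc ` P \<union> P \<union> (\<lambda>j. j + 2) ` P)) \<le> Suc (card (Suc ` P \<union> P \<union> (\<lambda>j. j + 2) ` P))"
    using fin by (intro card_insert_le_m1) auto
  also have "\<dots> \<le> Suc (card (Suc ` P) + card P + card ((\<lambda>j. j + 2) ` P))"
    by (intro Suc_leI le_imp_less_Suc order_trans[OF card_Un_le] add_mono card_Un_le order_refl)
  also have "\<dots> \<le> Suc (card P + card P + card P)"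
    using card_image_le[OF fin, of Suc] card_image_le[OF fin, of "\<lambda>j. j + 2"] by simp
  finally show ?thesis using P by (simp add: block_ends_def Let_def P_def)
qed

lemma suffix_blocks_word:
  assumes "s < length (blocks_word es)"
  obtains k y where "drop s (blocks_word es) = replicate k 0 @ 1 # y"
proof -
  have "\<exists>k y. drop s (blocks_word es) = replicate k 0 @ 1 # y"
    using assms
  proof (induction es arbitrary: s)
    case (Cons e es)
    consider "s \<le> e" | s' where "s = e + 1 + s'" using le_Suc_ex[of "e + 1" s] by force
    then show ?case
    proof cases
      case 1
      then have "drop s (blocks_word (e # es)) = replicate (e - s) 0 @ 1 # blocks_word es" by simp
      then show ?thesis by blast
    next
      case 2
      then have "drop s (blocks_word (e # es)) = drop s' (blocks_word es)" by simp
      then show ?thesis using Cons 2 by simp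
    qed
  qed simp
  then show ?thesis using that by blast
qed

lemma zero_run_le:
  assumes "drop s (blocks_word es) = replicate k 0 @ 1 # y" "\<And>e. e \<in> set es \<Longrightarrow> e \<le> N"
  shows "k \<le> N"
  using assms
proof (induction es arbitrary: s)
  case (Cons e es)
  consider "s \<le> e" | s' where "s = e + 1 + s'" using le_Suc_ex[of "e + 1" s] by force
  then show ?case
  proof cases
    case 1
    then have "replicate (e - s) 0 @ 1 # blocks_word es = replicate k 0 @ 1 # y"
      using Cons.prems(1) by simp
    then have "k = e - s" using replicate_Cons_eq_iff[of "0::nat" 1] by simp
    then show ?thesis using Cons.prems(2)[of e] by simp
  next
    case 2
    then have "drop s' (blocks_word es) = replicate k 0 @ 1 # y" using Cons.prems(1) by simp
    then show ?thesis using Cons.IH Cons.prems(2) by simp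
  qed
qed simp

text \<open>
  A phrase that starts neither at a 1 nor at the first symbol of a run of 0s only has to reach the
  end of its run.
\<close>

lemma reach_block_end:
  assumes "s < length (blocks_word es)" "1 \<le> g"
    and inner: "\<And>k y. 0 < s \<Longrightarrow> 1 \<le> k \<Longrightarrow> blocks_word es ! (s - 1) = 0 \<Longrightarrow>
      drop s (blocks_word es) = replicate k 0 @ 1 # y \<Longrightarrow> s + k \<le> length (blocks_word es) \<Longrightarrow>
      s + k \<in> block_ends (blocks_word es) \<Longrightarrow>
      \<exists>e\<in>E. s < e \<and> e \<le> s + g \<and> e \<le> length (blocks_word es)"
    and E: "block_ends (blocks_word es) \<subseteq> E"
  shows "\<exists>e\<in>E. s < e \<and> e \<le> s + g \<and> e \<le> length (blocks_word es)"
proof -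
  let ?w = "blocks_word es"
  obtain k y where ky: "drop s ?w = replicate k 0 @ 1 # y" by (rule suffix_blocks_word[OF assms(1)])
  have "length (drop s ?w) = k + Suc (length y)" using ky by simp
  then have sk: "s + k < length ?w" using assms(1) by simp
  have "?w ! (s + k) = drop s ?w ! k" using sk by simp
  then have "?w ! (s + k) \<noteq> 0" using ky by (simp add: nth_append)
  note ends = block_ends_intros[OF sk this]
  show ?thesis
  proof (cases "k = 0 \<or> s = 0 \<or> ?w ! (s - 1) \<noteq> 0")
    case True
    have "Suc s \<in> block_ends ?w"
    proof -
      consider "k = 0" | "s = 0" | "0 < s" "?w ! (s - 1) \<noteq> 0" using True by blast
      then show ?thesis
      proof cases
        case 3
        then show ?thesis using block_ends_intros(3)[of "s - 1" ?w] assms(1) by simp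
      qed (use ends(1) in \<open>auto simp: block_ends_def Let_def\<close>)
    qed
    then show ?thesis using assms(1,2) E by (intro bexI[of _ "Suc s"]) auto
  next
    case False
    then show ?thesis using inner[OF _ _ _ ky] sk ends(2) by simp
  qed
qed

text \<open>Inside a run, the suffix that starts one position earlier has one more leading 0. It is
  therefore smaller and shares all remaining 0s of the run, so the phrase reaches the end of the
  run.\<close>

lemma lex_v_blocks_word: "lex_v (blocks_word es) \<le> 3 * length es + 1"
proof -
  let ?w = "blocks_word es"
  have "length (parse lex_length [] ?w) \<le>
      length ([] :: str list) + card {e \<in> block_ends ?w. length (concat [] :: str) < e}"
  proof (rule length_parse_le_card[where I = "\<lambda>_. True"])
    fix ps x
    assume w: "concat ps @ x = ?w" and x: "x \<noteq> []"
    let ?s = "length (concat ps)"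
    have s: "?s < length ?w" using w x by (metis length_append length_greater_0_conv less_add_same_cancel1)
    have xd: "x = drop ?s ?w" using w by (metis append_eq_conv_conj)
    show "\<exists>e\<in>block_ends ?w. ?s < e \<and> e \<le> ?s + max 1 (lex_length ps x) \<and> e \<le> length ?w"
    proof (rule reach_block_end[OF s])
      fix k y
      assume s0: "0 < ?s" and k: "1 \<le> k" and z: "?w ! (?s - 1) = 0"
        and ky: "drop ?s ?w = replicate k 0 @ 1 # y" and n: "?s + k \<le> length ?w"
        and e: "?s + k \<in> block_ends ?w"
      let ?y = "drop (?s - 1) ?w"
      have "?y = 0 # x"
        using Cons_nth_drop_Suc[of "?s - 1" ?w] s s0 z xd by simp
      then have y_eq: "?y = replicate k 0 @ 0 # 1 # y" using xd ky by (simp add: replicate_app_Cons_same)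
      have x_eq: "x = replicate k 0 @ 1 # y" using xd ky by simp
      have "?y < x" unfolding y_eq x_eq by (simp add: list_less_append_iff)
      moreover have "suffix ?y (concat ps @ x)" unfolding w by (rule suffix_drop)
      moreover have "?y \<noteq> []" unfolding y_eq by simp
      ultimately have "?y \<in> lex_smaller_suffixes (concat ps @ x) x"
        unfolding lex_smaller_suffixes_def by blast
      then have "length (replicate k (0::nat)) \<le> lex_length ps x"
        by (rule lex_length_ge, unfold y_eq x_eq) auto
      then show "\<exists>e\<in>block_ends ?w. ?s < e \<and> e \<le> ?s + max 1 (lex_length ps x) \<and> e \<le> length ?w"
        using e n k by (intro bexI[of _ "?s + k"]) auto
    qed auto
  qed (auto simp: finite_block_ends)
  also have "\<dots> \<le> card (block_ends ?w)" by (auto intro!: card_mono simp: finite_block_ends)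
  also have "\<dots> \<le> 3 * length es + 1" by (rule card_block_ends)
  finally show ?thesis by (simp add: lex_v_def)
qed

text \<open>
  The first run is consumed by doubling, and its length is a power of 2, so that a phrase ends
  exactly at its end. From then on, this phrase end is available to copy every run.
\<close>

lemma greedy_blocks_word:
  assumes P1: "\<And>ps x u. lz_end_source ps x u \<Longrightarrow> u \<noteq> [] \<Longrightarrow> P ps x u"
    and P2: "\<And>ps x u. P ps x u \<Longrightarrow> u \<noteq> [] \<Longrightarrow> lz_source ps x u"
    and es: "\<And>e. e \<in> set es \<Longrightarrow> e \<le> 2 ^ K"
  shows "length (parse (greedy P) [] (blocks_word (2 ^ K # es))) \<le> 3 * length es + K + 5"
proof -
  let ?es = "2 ^ K # es"
  let ?w = "blocks_word ?es" and ?N = "2 ^ K :: nat"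
  let ?E = "block_ends ?w \<union> (\<lambda>i. 2 ^ i) ` {..K}"
  \<comment> \<open>The text parsed up to such a phrase end is \<open>replicate ?N 0\<close>, and
    every later run, being no longer, is a suffix of it.\<close>
  let ?I = "\<lambda>ps. ?N \<le> length (concat ps) \<longrightarrow>
    (\<exists>t\<in>{1..length ps}. concat (take t ps) = replicate ?N (0::nat))"
  have nth0: "?w ! i = 0" if "i < ?N" for i using that by (simp add: nth_append)
  have nthN: "?w ! ?N = 1" by (simp add: nth_append)
  have lenw: "?N < length ?w" by simp
  have take_w: "take s ?w = replicate s 0" if "s \<le> ?N" for s
    using that by (simp add: take_append min_def)
  have "length (parse (greedy P) [] ?w) \<le>
      length ([] :: str list) + card {e \<in> ?E. length (concat [] :: str) < e}"
  proof (rule length_parse_le_card[where I = ?I])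
    fix ps x
    assume I: "?I ps" and w: "concat ps @ x = ?w" and x: "x \<noteq> []"
    let ?s = "length (concat ps)" and ?g = "greedy P ps x"
    have s: "?s < length ?w" using w x by (metis length_append length_greater_0_conv less_add_same_cancel1)
    have xd: "x = drop ?s ?w" using w by (metis append_eq_conv_conj)
    have pd: "concat ps = take ?s ?w" using w by (metis append_eq_conv_conj)
    show "\<exists>e\<in>?E. ?s < e \<and> e \<le> ?s + max 1 ?g \<and> e \<le> length ?w"
    proof (rule reach_block_end[OF s])
      fix k y
      assume s0: "0 < ?s" and k: "1 \<le> k" and ky: "drop ?s ?w = replicate k 0 @ 1 # y"
        and n: "?s + k \<le> length ?w" and e: "?s + k \<in> block_ends ?w"
      have x_eq: "x = replicate k 0 @ 1 # y" using xd ky by simp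
      show "\<exists>e\<in>?E. ?s < e \<and> e \<le> ?s + max 1 ?g \<and> e \<le> length ?w"
      proof (cases "?N \<le> ?s")
        case True
        then obtain t where t: "t \<in> {1..length ps}" "concat (take t ps) = replicate ?N 0"
          using I by blast
        have "k \<le> ?N" using zero_run_le[OF ky, of ?N] es by auto
        then have "replicate ?N (0::nat) = replicate (?N - k) 0 @ replicate k 0"
          by (simp flip: replicate_add)
        then have "suffix (take k x) (concat (take t ps))"
          unfolding t(2) x_eq by (simp add: suffix_def)
        then have "P ps x (take k x)" using t(1) k x_eq by (intro P1) (auto simp: lz_end_source_def)
        then have "k \<le> ?g" using k x_eq by (intro greedy_ge) auto
        then show ?thesis using e n k by (intro bexI[of _ "?s + k"]) auto
      next
        case False
        then have sN: "?s < ?N" by simp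
        \<comment> \<open>The checkpoint aimed at is the next power of 2 after \<open>?s\<close>.
          From \<open>2 ^ i \<le> ?s\<close> the missing length \<open>l\<close> is at most
          \<open>?s\<close>, so the \<open>l\<close> zeros are a suffix of the text parsed so far,
          which ends at a phrase end.\<close>
        obtain i where i: "2 ^ i \<le> ?s" "?s < 2 ^ (i + 1)"
          using ex_power_ivl1[of 2 ?s] s0 by auto
        have "2 ^ i < (2 ^ K :: nat)" using i(1) sN by linarith
        then have iK: "i + 1 \<le> K" by simp
        then have eN: "2 ^ (i + 1) \<le> ?N" by (intro power_increasing) auto
        define l where "l = 2 ^ (i + 1) - ?s"
        have l: "1 \<le> l" "l \<le> ?s" "?s + l \<le> ?N" "?s + l = 2 ^ (i + 1)"
          using i eN by (auto simp: l_def)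
        have "x = replicate (?N - ?s) 0 @ 1 # blocks_word es" using xd sN by simp
        then have tx: "take l x = replicate l 0" and lx: "l \<le> length x"
          using l(3) by (simp_all add: take_append min_def)
        have "concat ps = replicate ?s 0" using pd take_w[of ?s] sN by simp
        also have "\<dots> = replicate (?s - l) 0 @ replicate l 0"
          using l(2) by (simp flip: replicate_add)
        finally obtain a where "concat ps = a @ take l x" using tx by metis
        then have "suffix (take l x) (concat (take (length ps) ps))" by (simp add: suffix_def)
        moreover have "1 \<le> length ps" using s0 by (cases ps) auto
        moreover have "take l x \<noteq> []" using tx l(1) by simp
        ultimately have "P ps x (take l x)"
          by (intro P1) (auto simp: lz_end_source_def intro!: bexI[of _ "length ps"])
        then have "l \<le> ?g" using l lx by (intro greedy_ge) auto
        moreover have "?s + l \<in> ?E" using iK unfolding l(4) by blast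
        ultimately show ?thesis using l lenw by (intro bexI[of _ "?s + l"]) auto
      qed
    qed auto
    show "?I (ps @ [take (max 1 ?g) x])"
    proof (cases "?N \<le> ?s")
      case True
      then obtain t where "t \<in> {1..length ps}" "concat (take t ps) = replicate ?N 0" using I by blast
      then show ?thesis by (intro impI bexI[of _ t]) auto
    next
      case False
      let ?h = "max 1 ?g"
      \<comment> \<open>A longer phrase would contain the first 1, and its source, starting further
        left, would put a 1 inside the first run. So the phrase that completes this run ends exactly
        with it.\<close>
      have le: "?s + ?h \<le> ?N"
      proof (rule ccontr)
        assume over: "\<not> ?s + ?h \<le> ?N"
        then have g: "1 \<le> ?g" "?N - ?s < ?g" using False by (auto simp: max_def split: if_splits)
        have gx: "?g \<le> length x" by (rule greedy_le)
        have "take ?g x \<noteq> []" using g(1) gx by (cases x) auto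
        then have "lz_source ps x (take ?g x)" using P2 greedy_holds[OF g(1)] by blast
        then obtain q where q: "1 \<le> q" "q \<le> ?s" "prefix (take ?g x) (drop (q - 1) ?w)"
          using w by (auto simp: lz_source_def)
        then obtain v where v: "drop (q - 1) ?w = take ?g x @ v" by (auto simp: prefix_def)
        have "drop (q - 1) ?w ! (?N - ?s) = x ! (?N - ?s)"
          unfolding v using g gx by (simp add: nth_append)
        also have "x ! (?N - ?s) = 1" using xd False by (simp add: nth_append)
        finally have "?w ! (q - 1 + (?N - ?s)) = 1" using q s by (simp del: blocks_word_simps)
        moreover have "q - 1 + (?N - ?s) < ?N" using q False by linarith
        ultimately show False using nth0 by (metis zero_neq_one)
      qed
      show ?thesis
      proof
        assume "?N \<le> length (concat (ps @ [take ?h x]))"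
        moreover have "length (concat (ps @ [take ?h x])) \<le> ?s + ?h" by simp
        ultimately have eq: "length (concat (ps @ [take ?h x])) = ?N" using le by linarith
        have "concat (ps @ [take ?h x]) @ drop ?h x = ?w" using w by simp
        then have "concat (ps @ [take ?h x]) = take ?N ?w" using eq by (metis append_eq_conv_conj)
        then show "\<exists>t\<in>{1..length (ps @ [take ?h x])}. concat (take t (ps @ [take ?h x])) = replicate ?N 0"
          using take_w[of ?N] by (intro bexI[of _ "length (ps @ [take ?h x])"]) auto
      qed
    qed
  qed (auto simp: finite_block_ends)
  also have "\<dots> \<le> card ?E" by (auto intro!: card_mono simp: finite_block_ends)
  also have "\<dots> \<le> card (block_ends ?w) + card ((\<lambda>i. 2 ^ i :: nat) ` {..K})" by (rule card_Un_le)
  also have "\<dots> \<le> (3 * length ?es + 1) + (K + 1)"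
    using card_block_ends[of ?es] card_image_le[of "{..K}" "\<lambda>i. 2 ^ i :: nat"] by (intro add_mono) auto
  finally show ?thesis by simp
qed

section \<open>Words with bounded \<open>ell\<close> and unbounded \<delta>\<close>

section \<open>Strings with a small L-system\<close>

definition run_morph :: "nat \<Rightarrow> str" where
  "run_morph a = (if a = 2 then [2, 1] else if a = 1 then [1, 0] else [0])"

definition runs_word :: "nat \<Rightarrow> str" where
  "runs_word d = 2 # concat (map (\<lambda>j. 1 # replicate j 0) [0..<d])"

lemma morph_run_morph_zeros: "morph run_morph (replicate j 0) = replicate j 0"
  by (induction j) (auto simp: run_morph_def)

lemma morph_concat: "morph \<phi> (concat us) = concat (map (morph \<phi>) us)"
  by (induction us) auto

lemma morph_pow_run_morph: "(morph run_morph ^^ d) [2] = runs_word d"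
proof (induction d)
  case (Suc d)
  have "(morph run_morph ^^ Suc d) [2] = morph run_morph (runs_word d)" using Suc by simp
  also have "\<dots> = 2 # 1 # concat (map (\<lambda>j. 1 # replicate (Suc j) 0) [0..<d])"
    unfolding runs_word_def by (simp add: morph_concat o_def morph_run_morph_zeros run_morph_def)
  also have "\<dots> = runs_word (Suc d)"
    unfolding runs_word_def by (simp only: map_upt_Suc) (simp add: o_def)
  finally show ?case .
qed (simp add: runs_word_def)

lemma runs_word_Suc: "runs_word (Suc d) = runs_word d @ 1 # replicate d 0"
  by (simp add: runs_word_def)

lemma prefix_runs_word: "d \<le> d' \<Longrightarrow> prefix (runs_word d) (runs_word d')"
  by (induction rule: dec_induct) (auto simp: runs_word_Suc)

lemma length_runs_word: "d < length (runs_word d)"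
  by (induction d) (auto simp: runs_word_Suc, simp add: runs_word_def)

text \<open>The size is 5 for the rules, 1 for the axiom, 3 for the alphabet and the constant 2.
  With \<open>2 \<le> d\<close> the word has length at least 3, so the alphabet is within its
  bound.\<close>

lemma ell_runs_word:
  assumes "1 \<le> C" "2 \<le> d"
  shows "ell C (runs_word d) \<le> 11"
proof -
  let ?n = "length (runs_word d)"
  define L where "L = \<lparr>ls_alph = {0,1,2}, ls_rule = run_morph, ls_coding = id, ls_axiom = [2],
    ls_levels = d, ls_length = ?n\<rparr>"
  have n: "?n \<le> ?n ^ C" using assms length_runs_word[of d] self_le_power[of ?n C] by simp
  have "lsystem C L"
    using assms n length_runs_word[of d]
    unfolding lsystem_def L_def by (simp add: morph_pow_run_morph) (simp add: run_morph_def)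
  moreover have "ls_string L = runs_word d"
    by (simp add: ls_string_def L_def morph_pow_run_morph)
  moreover have "ls_size L = 11"
    by (simp add: ls_size_def L_def run_morph_def)
  ultimately show ?thesis using ell_le by metis
qed

text \<open>The block with \<open>j\<close> zeros stands between those with \<open>j - 1\<close> and
  \<open>j + 1\<close> zeros, which provide the \<open>i\<close> zeros on the left and the
  \<open>l\<close> zeros on the right.\<close>

lemma sublist_runs_word:
  assumes "0 < j" "i < j" "l \<le> Suc j" "Suc j < d"
  shows "sublist (replicate i 0 @ 1 # replicate j 0 @ 1 # replicate l 0) (runs_word d)"
proof -
  let ?B = "\<lambda>j. 1 # replicate j (0::nat)"
  have "runs_word (Suc (Suc j)) = runs_word (j - 1) @ ?B (j - 1) @ ?B j @ ?B (Suc j)"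
    using runs_word_Suc[of "j - 1"] runs_word_Suc[of j] runs_word_Suc[of "Suc j"] assms(1)
    by (simp del: replicate_Suc)
  then have "sublist (?B (j - 1) @ ?B j @ ?B (Suc j)) (runs_word (Suc (Suc j)))"
    by (metis append_Nil2 sublist_appendI)
  also have "sublist (runs_word (Suc (Suc j))) (runs_word d)"
    using assms by (intro prefix_imp_sublist prefix_runs_word) simp
  finally have "sublist (?B (j - 1) @ ?B j @ ?B (Suc j)) (runs_word d)" .
  moreover have "sublist (replicate i 0 @ 1 # replicate j 0 @ 1 # replicate l 0)
      (?B (j - 1) @ ?B j @ ?B (Suc j))"
  proof -
    have "replicate (j - 1) (0::nat) = replicate (j - 1 - i) 0 @ replicate i 0"
      using assms by (simp flip: replicate_add)
    moreover have "replicate (Suc j) (0::nat) = replicate l 0 @ replicate (Suc j - l) 0"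
      using assms by (simp flip: replicate_add del: replicate_Suc)
    ultimately have "?B (j - 1) @ ?B j @ ?B (Suc j) =
        (1 # replicate (j - 1 - i) 0) @ (replicate i 0 @ 1 # replicate j 0 @ 1 # replicate l 0)
        @ replicate (Suc j - l) 0" by simp
    then show ?thesis by (metis sublist_appendI)
  qed
  ultimately show ?thesis by (rule sublist_order.order_trans[rotated])
qed

text \<open>
  For \<open>i < m\<close> and \<open>2m \<le> j < 3m\<close>, the factor \<open>0\<^sup>i 1 0\<^sup>j 1 0\<^sup>l\<close> of length \<open>4m + 2\<close> lies in three
  consecutive blocks.
\<close>

lemma delta_runs_word:
  assumes "1 \<le> m"
  shows "real m / 6 \<le> delta (runs_word (3 * m + 2))"
proof -
  let ?w = "runs_word (3 * m + 2)" and ?k = "4 * m + 2"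
  let ?f = "\<lambda>(i, j). replicate i 0 @ 1 # replicate j 0 @ 1 # replicate (4 * m - i - j) (0::nat)"
  have inj: "inj_on ?f ({..<m} \<times> {2*m..<3*m})"
    by (auto simp: inj_on_def replicate_Cons_eq_iff)
  have "?f ` ({..<m} \<times> {2*m..<3*m}) \<subseteq> factors ?k ?w"
  proof (rule image_subsetI)
    fix p assume "p \<in> {..<m} \<times> {2 * m..<3 * m}"
    moreover obtain i j where p: "p = (i, j)" by fastforce
    ultimately have "sublist (?f (i, j)) ?w" "length (?f (i, j)) = ?k"
      by (auto intro!: sublist_runs_word[unfolded One_nat_def])
    then show "?f p \<in> factors ?k ?w" by (simp add: factors_def p)
  qed
  then have "card (?f ` ({..<m} \<times> {2*m..<3*m})) \<le> card (factors ?k ?w)"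
    by (rule card_mono[OF finite_factors])
  then have m2: "m * m \<le> card (factors ?k ?w)"
    by (simp only: card_image[OF inj]) (simp add: card_cartesian_product)
  moreover have "0 < m * m" using assms by simp
  ultimately have "0 < card (factors ?k ?w)" by (rule less_le_trans[rotated])
  then have "factors ?k ?w \<noteq> {}" by (metis card.empty less_irrefl)
  then obtain u where "sublist u ?w" "length u = ?k" unfolding factors_def by blast
  then have k: "?k \<le> length ?w" using sublist_length_le by metis
  \<comment> \<open>The m * m pairs share the length 4 m + 2, which is at most 6 m; this is the
    origin of the 6.\<close>
  have "real m * real ?k \<le> real m * (6 * real m)" using assms by (intro mult_left_mono) auto
  moreover have "0 < real ?k" by simp
  ultimately have "real m / 6 \<le> real (m * m) / real ?k"
    unfolding of_nat_mult by (simp add: pos_le_divide_eq)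
  also have "\<dots> \<le> real (card (factors ?k ?w)) / real ?k"
    using m2 by (intro divide_right_mono) (simp_all only: of_nat_le_iff of_nat_0_le_iff)
  also have "\<dots> \<le> delta ?w" using k by (intro delta_ge) auto
  finally show ?thesis .
qed

section \<open>Few words have a small L-system\<close>

section \<open>Counting L-systems\<close>

text \<open>
  An L-system over \<open>{..<k}\<close> as a list of lists: the axiom, followed by the rule of each symbol,
  headed by the coding of the symbol.
\<close>

definition decode_lsystem :: "nat list list \<times> nat \<times> nat \<Rightarrow> str" where
  "decode_lsystem = (\<lambda>(us, d, n). take n (map (\<lambda>a. hd (tl us ! a))
     ((morph (\<lambda>a. tl (tl us ! a)) ^^ d) (hd us))))"

definition lsystem_codes :: "nat \<Rightarrow> nat list list set" where
  "lsystem_codes s = {us. length us \<le> s \<and> length (concat us) \<le> s \<and> set (concat us) \<subseteq> {..s}}"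

lemma set_morph_pow_subset:
  assumes "\<And>a. a \<in> A \<Longrightarrow> set (\<phi> a) \<subseteq> A" "set u \<subseteq> A"
  shows "set ((morph \<phi> ^^ d) u) \<subseteq> A"
proof (induction d)
  case (Suc d)
  then show ?case using assms(1) by (auto simp: morph_def[of \<phi> "(morph \<phi> ^^ d) u"])
qed (use assms(2) in simp)

lemma map_morph_pow:
  assumes closed: "\<And>a. a \<in> A \<Longrightarrow> set (\<phi> a) \<subseteq> A"
    and \<psi>: "\<And>a. a \<in> A \<Longrightarrow> \<psi> (h a) = map h (\<phi> a)" and u: "set u \<subseteq> A"
  shows "(morph \<psi> ^^ d) (map h u) = map h ((morph \<phi> ^^ d) u)"
proof (induction d)
  case (Suc d)
  have "set ((morph \<phi> ^^ d) u) \<subseteq> A" using closed u by (rule set_morph_pow_subset)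
  then have "morph \<psi> (map h v) = map h (morph \<phi> v)" if "v = (morph \<phi> ^^ d) u" for v
    unfolding that[symmetric]
  proof (induction v)
    case (Cons a v)
    then show ?case using \<psi>[of a] by simp
  qed simp
  then show ?case using Suc by simp
qed simp

text \<open>A bijection renames the alphabet to an initial segment of the naturals. This changes
  neither the levels, up to renaming, nor the word, because the letters of the word come from the
  coding.\<close>

lemma decode_lsystem_surj:
  assumes L: "lsystem C L" and s: "ls_size L \<le> s" and bin: "set (ls_string L) \<subseteq> {0, 1}"
  obtains us where "us \<in> lsystem_codes s"
    "ls_string L = decode_lsystem (us, ls_levels L, ls_length L)"
proof -
  let ?A = "ls_alph L" and ?\<phi> = "ls_rule L" and ?k = "card (ls_alph L)"
  let ?u = "(morph ?\<phi> ^^ ls_levels L) (ls_axiom L)"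
  have fin: "finite ?A" and closed: "\<And>a. a \<in> ?A \<Longrightarrow> set (?\<phi> a) \<subseteq> ?A"
    and ax: "set (ls_axiom L) \<subseteq> ?A"
    using L by (auto simp: lsystem_def)
  obtain h where h: "bij_betw h ?A {0..<?k}" using ex_bij_betw_finite_nat[OF fin] by blast
  define g where "g = inv_into ?A h"
  have g: "g (h a) = a" if "a \<in> ?A" for a
    using h that by (simp add: g_def bij_betw_inv_into_left)
  have gA: "g i \<in> ?A" if "i < ?k" for i
    using bij_betwE[OF bij_betw_inv_into[OF h]] that by (simp add: g_def)
  have hk: "h a < ?k" if "a \<in> ?A" for a
    using bij_betwE[OF h] that by simp
  have s2: "?k + 2 \<le> s" "(\<Sum>a\<in>?A. length (?\<phi> a)) + length (ls_axiom L) + ?k + 2 \<le> s"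
    using s by (simp_all add: ls_size_def)
  \<comment> \<open>Symbols outside the generated prefix may be coded by arbitrarily large numbers.
    The cap \<open>min 1\<close> makes the code finite in number and leaves a binary word as it
    is.\<close>
  define row where "row i = min 1 (ls_coding L (g i)) # map h (?\<phi> (g i))" for i
  define us where "us = map h (ls_axiom L) # map row [0..<?k]"
  have "length us \<le> s" using s2 by (simp add: us_def)
  moreover have "length (concat us) \<le> s"
  proof -
    have "length (concat us) = length (ls_axiom L) + (\<Sum>i<?k. length (?\<phi> (g i)) + 1)"
      by (simp add: us_def length_concat o_def row_def sum_list_distinct_conv_sum_set atLeast0LessThan)
    also have "(\<Sum>i<?k. length (?\<phi> (g i)) + 1) = (\<Sum>i<?k. length (?\<phi> (g i))) + ?k"
      by (simp only: sum.distrib) simp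
    also have "(\<Sum>i<?k. length (?\<phi> (g i))) = (\<Sum>a\<in>?A. length (?\<phi> a))"
      using bij_betw_inv_into[OF h]
      by (intro sum.reindex_bij_betw) (simp add: g_def atLeast0LessThan)
    finally show ?thesis using s2 by simp
  qed
  moreover have "set (concat us) \<subseteq> {..s}"
  proof -
    have "set (map h (ls_axiom L)) \<subseteq> {..s}" using ax hk s2(1) by fastforce
    moreover have "set (row i) \<subseteq> {..s}" if "i < ?k" for i
    proof -
      have "h a \<le> s" if "a \<in> set (?\<phi> (g i))" for a
        using closed[OF gA[OF \<open>i < ?k\<close>]] that hk[of a] s2(1) by auto
      then show ?thesis using s2(1) by (auto simp: row_def)
    qed
    moreover have "set (concat us) = set (map h (ls_axiom L)) \<union> (\<Union>i<?k. set (row i))"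
      by (auto simp: us_def)
    ultimately show ?thesis by (simp add: UN_subset_iff)
  qed
  ultimately have codes: "us \<in> lsystem_codes s" by (simp add: lsystem_codes_def)
  have row: "tl us ! h a = min 1 (ls_coding L a) # map h (?\<phi> a)" if "a \<in> ?A" for a
    using hk[OF that] g[OF that] by (simp add: us_def row_def)
  have hd_us: "hd us = map h (ls_axiom L)" by (simp add: us_def)
  have "(morph (\<lambda>a. tl (tl us ! a)) ^^ ls_levels L) (hd us) = map h ?u"
    unfolding hd_us by (rule map_morph_pow[OF closed _ ax]) (simp_all add: row)
  moreover have "set ?u \<subseteq> ?A" using closed ax by (rule set_morph_pow_subset)
  then have "map (\<lambda>a. hd (tl us ! a)) (map h ?u) = map (\<lambda>a. min 1 (ls_coding L a)) ?u"
    using row by auto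
  ultimately have "decode_lsystem (us, ls_levels L, ls_length L) = map (min 1) (ls_string L)"
    by (auto simp: decode_lsystem_def ls_string_def take_map dest: in_set_takeD)
  also have "\<dots> = ls_string L"
    using bin by (intro map_idI) auto
  finally show ?thesis using codes that by simp
qed

lemma sum_powers_le: "(\<Sum>i\<le>n. q ^ i) \<le> (Suc q) ^ n"
proof (induction n)
  case (Suc n)
  have "q ^ n \<le> Suc q ^ n" by (rule power_mono) auto
  then have "q * q ^ n \<le> q * Suc q ^ n" by (rule mult_le_mono2)
  with Suc have "(\<Sum>i\<le>n. q ^ i) + q * q ^ n \<le> Suc q ^ n + q * Suc q ^ n" by (rule add_mono)
  then show ?case by simp
qed simp

lemma concat_eq_concat_imp_eq:
  "concat us = concat vs \<Longrightarrow> map length us = map length vs \<Longrightarrow> us = vs"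
proof (induction us arbitrary: vs)
  case (Cons u us)
  then show ?case by (cases vs) auto
qed simp

text \<open>A list of lists is recovered from its concatenation and the list of its lengths. Both
  have at most \<open>s\<close> entries, each at most \<open>s\<close>, and at most
  \<open>(s + 2) ^ s\<close> such lists exist.\<close>

lemma card_lsystem_codes:
  "finite (lsystem_codes s)" "card (lsystem_codes s) \<le> (s + 2) ^ (2 * s)"
proof -
  define Y where "Y = {xs. set xs \<subseteq> {..s} \<and> length xs \<le> s}"
  let ?f = "\<lambda>us :: nat list list. (concat us, map length us)"
  have Y: "finite Y" unfolding Y_def by (rule finite_lists_length_le) simp
  have "card Y = (\<Sum>i\<le>s. card {..s} ^ i)" unfolding Y_def by (rule card_lists_length_le) simp
  then have cY: "card Y \<le> (s + 2) ^ s" using sum_powers_le[of "s + 1" s] by simp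
  have inj: "inj_on ?f (lsystem_codes s)"
    using concat_eq_concat_imp_eq by (intro inj_onI) blast
  have sub: "?f ` lsystem_codes s \<subseteq> Y \<times> Y"
  proof (rule image_subsetI)
    fix us assume us: "us \<in> lsystem_codes s"
    have "length u \<le> s" if "u \<in> set us" for u
      using us member_le_sum_list[of "length u" "map length us"] that
      by (auto simp: lsystem_codes_def length_concat)
    then show "?f us \<in> Y \<times> Y" using us by (auto simp: Y_def lsystem_codes_def)
  qed
  then have fin: "finite (?f ` lsystem_codes s)" using Y finite_subset by blast
  then show "finite (lsystem_codes s)" using inj by (rule finite_imageD)
  have "card (lsystem_codes s) = card (?f ` lsystem_codes s)" using inj by (rule card_image[symmetric])
  also have "\<dots> \<le> card (Y \<times> Y)" using Y sub by (intro card_mono) auto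
  also have "\<dots> \<le> (s + 2) ^ s * (s + 2) ^ s" using cY by (simp only: card_cartesian_product mult_le_mono)
  finally show "card (lsystem_codes s) \<le> (s + 2) ^ (2 * s)" by (simp add: mult_2 power_add)
qed

text \<open>A code, a number of levels and a length determine the word. The polynomial bound on the
  levels enters here and makes the count depend on \<open>C\<close>.\<close>

lemma card_small_ell:
  assumes C: "1 \<le> C"
    and S: "\<And>w. w \<in> S \<Longrightarrow> w \<noteq> [] \<and> set w \<subseteq> {0, 1} \<and> length w \<le> N \<and> ell C w \<le> s"
  shows "card S \<le> (s + 2) ^ (2 * s) * (N ^ C + 1) * (N + 1)"
proof -
  let ?D = "lsystem_codes s \<times> {..N ^ C} \<times> {..N}"
  have "S \<subseteq> decode_lsystem ` ?D"
  proof
    fix w assume "w \<in> S"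
    note w = S[OF this]
    then obtain L where L: "lsystem C L" "ls_string L = w" "ell C w = ls_size L"
      using ell_attained[of w C] C by blast
    obtain us where us: "us \<in> lsystem_codes s"
      "ls_string L = decode_lsystem (us, ls_levels L, ls_length L)"
      by (rule decode_lsystem_surj[OF L(1), of s]) (use L w in auto)
    have n: "ls_length L \<le> N" using length_ls_string[OF L(1)] L(2) w by simp
    then have "ls_length L ^ C \<le> N ^ C" by (rule power_mono) simp
    moreover have "ls_levels L \<le> ls_length L ^ C" using L(1) by (simp add: lsystem_def)
    ultimately have "ls_levels L \<le> N ^ C" by simp
    then show "w \<in> decode_lsystem ` ?D" using us L(2) n by auto
  qed
  moreover have "finite ?D" using card_lsystem_codes(1) by auto
  ultimately have "card S \<le> card ?D" by (rule surj_card_le[rotated])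
  also have "\<dots> = card (lsystem_codes s) * (N ^ C + 1) * (N + 1)"
    by (simp only: card_cartesian_product card_atMost Suc_eq_plus1 mult.assoc)
  also have "\<dots> \<le> (s + 2) ^ (2 * s) * (N ^ C + 1) * (N + 1)"
    using card_lsystem_codes(2) by (intro mult_le_mono) auto
  finally show ?thesis .
qed

section \<open>Hard words: a lower bound for \<open>ell\<close> by counting\<close>

lemma length_blocks_word: "length (blocks_word es) = sum_list es + length es"
  by (induction es) auto

definition hard_word_exponents :: "nat \<Rightarrow> nat list set" where
  "hard_word_exponents K = {es. set es \<subseteq> {2 ^ K..<2 ^ (K + 1)} \<and> length es = K}"

definition hard_words :: "nat \<Rightarrow> str set" where
  "hard_words K = (\<lambda>es. blocks_word (2 ^ (K + 1) # es)) ` hard_word_exponents K"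

lemma card_hard_words: "card (hard_words K) = 2 ^ (K * K)"
proof -
  have "card (hard_words K) = card (hard_word_exponents K)"
    unfolding hard_words_def using inj_blocks_word
    by (intro card_image) (auto simp: inj_on_def inj_def simp del: blocks_word_simps)
  also have "\<dots> = card {2 ^ K..<2 ^ (K + 1) :: nat} ^ K"
    unfolding hard_word_exponents_def by (rule card_lists_length_eq) simp
  finally show ?thesis by (simp add: power_mult)
qed

lemma length_hard_words_ge: "w \<in> hard_words K \<Longrightarrow> K \<le> length w"
  using less_exp[of K] by (auto simp: hard_words_def length_blocks_word hard_word_exponents_def)

lemma length_hard_words:
  assumes "w \<in> hard_words K" "2 \<le> K"
  shows "length w \<le> 2 ^ (3 * K)"
proof -
  obtain es where es: "es \<in> hard_word_exponents K" "w = blocks_word (2 ^ (K + 1) # es)"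
    using assms by (auto simp: hard_words_def)
  have "sum_list es \<le> length es * 2 ^ (K + 1)"
    using sum_list_mono[of es "\<lambda>e. e" "\<lambda>_. 2 ^ (K + 1)"] es(1)
    by (force simp: hard_word_exponents_def sum_list_triv)
  then have "length w \<le> (K + 1) * (2 ^ (K + 1) + 1)"
    using es by (simp add: length_blocks_word hard_word_exponents_def algebra_simps)
  \<comment> \<open>The first factor counts the blocks, the second bounds the length of a block;
    together they give the exponent 3 K.\<close>
  also have "\<dots> \<le> 2 ^ K * 2 ^ (2 * K)"
  proof (rule mult_le_mono)
    show "K + 1 \<le> 2 ^ K" by (metis Suc_leI Suc_eq_plus1 less_exp)
    have "2 ^ 2 \<le> (2 :: nat) ^ K" using assms(2) by (intro power_increasing) auto
    then have "4 * 2 ^ K \<le> (2 :: nat) ^ K * 2 ^ K" by (intro mult_le_mono) auto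
    moreover have "1 \<le> (2 :: nat) ^ K" by simp
    ultimately show "2 ^ (K + 1) + 1 \<le> (2 :: nat) ^ (2 * K)"
      unfolding mult_2 power_add power_one_right by linarith
  qed
  also have "\<dots> = 2 ^ (3 * K)" by (simp flip: power_add)
  finally show ?thesis .
qed

text \<open>The threshold is sharp: 46 < 64 at 6, but 40 > 32 at 5. It causes the shift
  \<open>p + 6\<close> in the final family.\<close>

lemma six_mult_less_power: "6 \<le> p \<Longrightarrow> 6 * p + 10 < 2 ^ p"
  by (induction p rule: nat_induct_at_least) auto

text \<open>
  There are \<open>2 ^ (q ^ 4)\<close> hard words with \<open>K = q\<^sup>2\<close>, but only \<open>2 ^ O(q\<^sup>3 log q)\<close> L-systems of size at most
  \<open>q\<^sup>3\<close> with a number of levels that is bounded by the \<open>q\<close>-th power of the length.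
\<close>

lemma counting_bound:
  assumes p: "6 \<le> p" and q: "q = 2 ^ p"
  shows "(q ^ 3 + 2) ^ (2 * q ^ 3) * ((2 ^ (3 * q\<^sup>2)) ^ q + 1) * (2 ^ (3 * q\<^sup>2) + 1)
     < (2 :: nat) ^ (q\<^sup>2 * q\<^sup>2)"
proof -
  have q1: "1 \<le> q" by (simp add: q)
  have double: "2 ^ k + 1 \<le> (2 :: nat) ^ (k + 1)" for k by simp
  \<comment> \<open>As \<open>q\<close> is a power of 2, \<open>p\<close> replaces its logarithm and
    the whole comparison takes place between exponents.\<close>
  have "q ^ 3 = 2 ^ (3 * p)" unfolding q by (simp add: mult.commute flip: power_mult)
  moreover have "(2::nat) ^ 1 \<le> 2 ^ (3 * p)" using p by (intro power_increasing) auto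
  ultimately have "q ^ 3 + 2 \<le> 2 ^ (3 * p + 1)" by simp
  then have "(q ^ 3 + 2) ^ (2 * q ^ 3) \<le> (2 ^ (3 * p + 1)) ^ (2 * q ^ 3)" by (rule power_mono) simp
  also have "\<dots> = 2 ^ ((3 * p + 1) * (2 * q ^ 3))" by (simp only: power_mult)
  finally have 1: "(q ^ 3 + 2) ^ (2 * q ^ 3) \<le> 2 ^ ((3 * p + 1) * (2 * q ^ 3))" .
  have "(2 ^ (3 * q\<^sup>2)) ^ q = (2 :: nat) ^ (3 * q ^ 3)"
    by (simp add: power3_eq_cube power2_eq_square mult.assoc flip: power_mult)
  then have 2: "(2 ^ (3 * q\<^sup>2)) ^ q + 1 \<le> (2 :: nat) ^ (3 * q ^ 3 + 1)" by simp
  have "(q ^ 3 + 2) ^ (2 * q ^ 3) * ((2 ^ (3 * q\<^sup>2)) ^ q + 1) * (2 ^ (3 * q\<^sup>2) + 1)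
      \<le> 2 ^ ((3 * p + 1) * (2 * q ^ 3)) * 2 ^ (3 * q ^ 3 + 1) * 2 ^ (3 * q\<^sup>2 + 1)"
    by (intro mult_le_mono 1 2 double)
  also have "\<dots> = 2 ^ ((3 * p + 1) * (2 * q ^ 3) + (3 * q ^ 3 + 1) + (3 * q\<^sup>2 + 1))"
    by (simp only: power_add)
  also have "\<dots> < 2 ^ (q\<^sup>2 * q\<^sup>2)"
  proof (rule power_strict_increasing)
    have "q\<^sup>2 \<le> q ^ 3" using q1 by (intro power_increasing) auto
    moreover have "1 \<le> q ^ 3" using q1 by simp
    \<comment> \<open>6 p + 2 comes from the codes, 4 from the levels and 4 from the lengths, all in
      units of q^3.\<close>
    ultimately have "(3 * p + 1) * (2 * q ^ 3) + (3 * q ^ 3 + 1) + (3 * q\<^sup>2 + 1) \<le> (6 * p + 10) * q ^ 3"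
      by (simp add: algebra_simps)
    also have "\<dots> < q * q ^ 3"
      using six_mult_less_power[OF p] q q1 by (intro mult_strict_right_mono) auto
    also have "\<dots> = q\<^sup>2 * q\<^sup>2" by (simp add: power3_eq_cube power2_eq_square)
    finally show "(3 * p + 1) * (2 * q ^ 3) + (3 * q ^ 3 + 1) + (3 * q\<^sup>2 + 1) < q\<^sup>2 * q\<^sup>2" .
  qed simp
  finally show ?thesis .
qed

lemma hard_word_ell:
  assumes p: "6 \<le> p" and q: "q = 2 ^ p"
  shows "\<exists>w\<in>hard_words (q\<^sup>2). q ^ 3 < ell q w"
proof (rule ccontr)
  assume small: "\<not> (\<exists>w\<in>hard_words (q\<^sup>2). q ^ 3 < ell q w)"
  have q1: "1 \<le> q" by (simp add: q)
  have "2 ^ 1 \<le> q" unfolding q using p by (intro power_increasing) auto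
  moreover have "q \<le> q\<^sup>2" using q1 by (rule self_le_power) simp
  ultimately have K: "2 \<le> q\<^sup>2" by simp
  have "card (hard_words (q\<^sup>2)) \<le>
      (q ^ 3 + 2) ^ (2 * q ^ 3) * ((2 ^ (3 * q\<^sup>2)) ^ q + 1) * (2 ^ (3 * q\<^sup>2) + 1)"
  proof (rule card_small_ell[OF q1])
    fix w assume w: "w \<in> hard_words (q\<^sup>2)"
    then obtain es where "w = blocks_word (2 ^ (q\<^sup>2 + 1) # es)" unfolding hard_words_def by blast
    then have "w \<noteq> [] \<and> set w \<subseteq> {0, 1}" using set_blocks_word by fastforce
    then show "w \<noteq> [] \<and> set w \<subseteq> {0, 1} \<and> length w \<le> 2 ^ (3 * q\<^sup>2) \<and> ell q w \<le> q ^ 3"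
      using small w length_hard_words[OF w K] by (auto simp: not_less)
  qed
  then show False using counting_bound[OF p q] by (simp add: card_hard_words)
qed

section \<open>Assembly of the estimates\<close>

section \<open>Comparison of the measures\<close>

abbreviation (input) repetitiveness_measures :: "(str \<Rightarrow> real) set" where
  "repetitiveness_measures \<equiv> {delta, real \<circ> gamma, real \<circ> bms, real \<circ> lex_v, real \<circ> collage_c,
     real \<circ> rlslp_g, real \<circ> lz_z, real \<circ> lz_no_z, real \<circ> lz_end_z, real \<circ> bwt_r}"

text \<open>Macro-schemes and parsings pass through \<gamma>; collage systems, run-length grammars
  and the Burrows-Wheeler transform are compared with \<delta> directly.\<close>

lemma delta_le_measures:
  assumes "\<mu> \<in> repetitiveness_measures" "w \<noteq> []"
  shows "delta w \<le> 2 * \<mu> w"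
proof -
  have d0: "0 \<le> delta w" using assms(2) by (rule delta_nonneg)
  have dg: "delta w \<le> 2 * real k" if "gamma w \<le> k" for k
    using delta_le_gamma[OF assms(2)] that by linarith
  have "gamma w \<le> lz_z w" unfolding lz_z_def by (rule gamma_le_greedy)
  moreover have "gamma w \<le> lz_no_z w"
    unfolding lz_no_z_def by (rule gamma_le_greedy) (rule lz_no_imp_lz)
  moreover have "gamma w \<le> lz_end_z w"
    unfolding lz_end_z_def by (rule gamma_le_greedy) (blast intro: lz_no_imp_lz lz_end_imp_no)
  moreover have "delta w \<le> 2 * real (collage_c w)" by (rule delta_le_collage_c[OF assms(2)])
  moreover have "delta w \<le> 2 * real (rlslp_g w)"
    using delta_le_collage_c[OF assms(2)] collage_c_le_rlslp_g[OF assms(2)] by linarith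
  moreover have "delta w \<le> 2 * real (bwt_r w)" using delta_le_bwt_r[OF assms(2)] by linarith
  ultimately show ?thesis
    using assms(1) dg[OF gamma_le_bms] dg[OF gamma_le_lex_v] dg[OF order_refl] d0 dg by auto
qed

lemma measures_hard_word:
  assumes "\<mu> \<in> repetitiveness_measures" "w \<in> hard_words K" "1 \<le> K"
  shows "0 \<le> \<mu> w" "\<mu> w \<le> 12 * real K"
proof -
  obtain es where es: "set es \<subseteq> {2 ^ K..<2 ^ (K + 1)}" "length es = K"
    and w: "w = blocks_word (2 ^ (K + 1) # es)"
    using assms(2) by (auto simp: hard_words_def hard_word_exponents_def)
  let ?es = "2 ^ (K + 1) # es"
  have ne: "w \<noteq> []" unfolding w by simp
  have "2 ^ 1 \<le> (2 :: nat) ^ K" using assms(3) by (intro power_increasing) auto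
  then have ge2: "2 \<le> e" if "e \<in> set ?es" for e using es(1) that by fastforce
  have small: "e \<le> 2 ^ (K + 1)" if "e \<in> set es" for e using es(1) that by fastforce
  have len: "length ?es = K + 1" using es(2) by simp
  have "rlslp_g (blocks_word ?es) \<le> 4 * length ?es" by (rule rlslp_g_blocks_word[OF ge2]) auto
  then have rl: "rlslp_g w \<le> 4 * (K + 1)" by (simp only: w len)
  have "bms (blocks_word ?es) \<le> 3 * length ?es" by (rule bms_blocks_word[OF ge2])
  then have b: "bms w \<le> 3 * (K + 1)" by (simp only: w len)
  have "lex_v (blocks_word ?es) \<le> 3 * length ?es + 1" by (rule lex_v_blocks_word)
  then have v: "lex_v w \<le> 3 * (K + 1) + 1" by (simp only: w len)
  have "bwt_r (blocks_word ?es) \<le> 2 * length ?es + 1" by (rule bwt_r_blocks_word)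
  then have r: "bwt_r w \<le> 2 * (K + 1) + 1" by (simp only: w len)
  have g: "length (parse (greedy P) [] w) \<le> 4 * K + 6"
    if P: "\<And>ps x u. lz_end_source ps x u \<Longrightarrow> u \<noteq> [] \<Longrightarrow> P ps x u"
       "\<And>ps x u. P ps x u \<Longrightarrow> u \<noteq> [] \<Longrightarrow> lz_source ps x u" for P
  proof -
    have "length (parse (greedy P) [] w) \<le> 3 * length es + (K + 1) + 5"
      unfolding w by (rule greedy_blocks_word[OF P small])
    then show ?thesis using es(2) by simp
  qed
  have "lz_z w \<le> 4 * K + 6"
    unfolding lz_z_def by (rule g) (blast intro: lz_no_imp_lz lz_end_imp_no)+
  moreover have "lz_no_z w \<le> 4 * K + 6"
    unfolding lz_no_z_def by (rule g) (blast intro: lz_no_imp_lz lz_end_imp_no)+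
  moreover have "lz_end_z w \<le> 4 * K + 6"
    unfolding lz_end_z_def by (rule g) (blast intro: lz_no_imp_lz lz_end_imp_no)+
  moreover have "collage_c w \<le> 4 * (K + 1)" using collage_c_le_rlslp_g[OF ne] rl by (rule order_trans)
  moreover have "gamma w \<le> 3 * (K + 1)" using gamma_le_bms b by (rule order_trans)
  moreover from this have "real (gamma w) \<le> real (3 * (K + 1))" unfolding of_nat_le_iff by simp
  then have "delta w \<le> 3 * (real K + 1)" using delta_le_gamma[OF ne] by simp
  \<comment> \<open>The largest of the bounds is 4 K + 6, and \<open>1 \<le> K\<close> absorbs the
    additive constants.\<close>
  ultimately show "\<mu> w \<le> 12 * real K"
    using assms(1,3) rl b v r by auto
  show "0 \<le> \<mu> w" using assms(1) delta_nonneg[OF ne] by auto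
qed

lemma ell_smallo_measure:
  assumes \<mu>: "\<mu> \<in> repetitiveness_measures" and C: "1 \<le> C"
  shows "(real \<circ> ell C) \<in> o[along (range (\<lambda>m. runs_word (3 * m + 2)))](\<mu>)"
proof (rule landau_o.smallI)
  fix c :: real
  assume c: "0 < c"
  show "eventually (\<lambda>w. norm ((real \<circ> ell C) w) \<le> c * norm (\<mu> w))
      (along (range (\<lambda>m. runs_word (3 * m + 2))))"
  \<comment> \<open>132 is 11 * 12: \<open>ell\<close> is at most 11, and \<mu> is at least m / 12,
    half of the bound m / 6 for \<delta>.\<close>
  proof (rule eventually_along_range[where Q = "max 1 (nat \<lceil>132 / c\<rceil>)"])
    fix m assume m: "max 1 (nat \<lceil>132 / c\<rceil>) \<le> m"
    let ?w = "runs_word (3 * m + 2)"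
    have ne: "?w \<noteq> []" by (simp add: runs_word_def)
    have "132 / c \<le> real m" using m by linarith
    then have "11 \<le> c * (real m / 12)" using c by (simp add: field_simps)
    also have "real m / 12 \<le> \<mu> ?w"
      using delta_runs_word[of m] delta_le_measures[OF \<mu> ne] m by linarith
    then have "c * (real m / 12) \<le> c * \<mu> ?w" using c by (intro mult_left_mono) auto
    also have "\<dots> \<le> c * norm (\<mu> ?w)" using c by (intro mult_left_mono) auto
    finally show "norm ((real \<circ> ell C) ?w) \<le> c * norm (\<mu> ?w)"
      using ell_runs_word[OF C, of "3 * m + 2"] by simp
  qed
qed

lemma measure_smallo_ell:
  assumes \<mu>: "\<mu> \<in> repetitiveness_measures" and C: "1 \<le> C"
    and f: "\<And>p. f p \<in> hard_words ((2 ^ (p + 6))\<^sup>2)" "\<And>p. (2 ^ (p + 6)) ^ 3 < ell (2 ^ (p + 6)) (f p)"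
  shows "\<mu> \<in> o[along (range f)](real \<circ> ell C)"
proof (rule landau_o.smallI)
  fix c :: real
  assume c: "0 < c"
  show "eventually (\<lambda>w. norm (\<mu> w) \<le> c * norm ((real \<circ> ell C) w)) (along (range f))"
  \<comment> \<open>Beyond \<open>C\<close> the exponent q = 2 ^ (p + 6) used for the p-th word
    exceeds \<open>C\<close>, so \<open>ell_antimono\<close> applies. Then \<mu> is at most 12 q^2
    against \<open>ell\<close> above q^3, and a ratio of 12 / q is at most \<open>c\<close> from 12
    / c on.\<close>
  proof (rule eventually_along_range[where Q = "max C (nat \<lceil>12 / c\<rceil>)"])
    fix p assume p: "max C (nat \<lceil>12 / c\<rceil>) \<le> p"
    define q :: nat where "q = 2 ^ (p + 6)"
    have "p < q" using less_exp[of "p + 6"] unfolding q_def by linarith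
    then have q: "C \<le> q" "12 / c \<le> real q" "1 \<le> q" using p by linarith+
    have fp: "f p \<in> hard_words (q\<^sup>2)" "q ^ 3 < ell q (f p)" using f[of p] by (simp_all add: q_def)
    have "f p \<noteq> []" using length_hard_words_ge[OF fp(1)] q(3) by auto
    then have "ell q (f p) \<le> ell C (f p)" using C q(1) by (rule ell_antimono)
    then have "real (q ^ 3) \<le> real (ell C (f p))" using fp(2) unfolding of_nat_le_iff by linarith
    then have ell: "real q ^ 3 \<le> real (ell C (f p))" by simp
    have "1 \<le> q\<^sup>2" using q(3) by simp
    note \<mu>_bounds = measures_hard_word[OF \<mu> fp(1) this]
    have "12 \<le> c * real q" using q(2) c by (simp add: field_simps)
    then have "12 * real q ^ 2 \<le> (c * real q) * real q ^ 2" by (intro mult_right_mono) auto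
    also have "\<dots> = c * real q ^ 3" by (simp add: power3_eq_cube power2_eq_square)
    also have "\<dots> \<le> c * real (ell C (f p))" using c ell by (intro mult_left_mono) auto
    finally show "norm (\<mu> (f p)) \<le> c * norm ((real \<circ> ell C) (f p))"
      using \<mu>_bounds by simp
  qed
qed

theorem theorem1:
  shows
    "(\<forall>\<mu> \<in> {delta, real \<circ> gamma, real \<circ> bms, real \<circ> lex_v, real \<circ> collage_c, real \<circ> rlslp_g,
             real \<circ> lz_z, real \<circ> lz_no_z, real \<circ> lz_end_z, real \<circ> bwt_r}.
        (\<exists>W. string_family W \<and> (\<forall>C\<ge>1. (real \<circ> ell C) \<in> o[along W](\<mu>))) \<and>
        (\<exists>W. string_family W \<and> (\<forall>C\<ge>1. \<mu> \<in> o[along W](real \<circ> ell C)))) \<and>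
     (\<forall>W. string_family W \<longrightarrow>
        (\<forall>C\<ge>1. (real \<circ> ell C) \<in> O[along W](real \<circ> slp_g) \<and>
                (real \<circ> ell C) \<in> \<Omega>[along W](real \<circ> nu C)))"
proof (intro conjI ballI allI impI)
  fix \<mu> assume \<mu>: "\<mu> \<in> repetitiveness_measures"
  have "string_family (range (\<lambda>m. runs_word (3 * m + 2)))"
  proof (rule string_family_range)
    show "m \<le> length (runs_word (3 * m + 2))" for m
      using length_runs_word[of "3 * m + 2"] by linarith
  qed
  then show "\<exists>W. string_family W \<and> (\<forall>C\<ge>1. (real \<circ> ell C) \<in> o[along W](\<mu>))"
    using ell_smallo_measure[OF \<mu>] by blast
  \<comment> \<open>The choice of \<open>f\<close> depends on neither \<mu> nor
    \<open>C\<close>.\<close>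
  have "\<forall>p. \<exists>w. w \<in> hard_words ((2 ^ (p + 6))\<^sup>2) \<and> (2 ^ (p + 6)) ^ 3 < ell (2 ^ (p + 6)) w"
    using hard_word_ell[OF _ refl] by (metis le_add2)
  then obtain f where f: "\<And>p. f p \<in> hard_words ((2 ^ (p + 6))\<^sup>2)"
    "\<And>p. (2 ^ (p + 6)) ^ 3 < ell (2 ^ (p + 6)) (f p)" by metis
  have "string_family (range f)"
  proof (rule string_family_range)
    fix p
    have "p \<le> 2 ^ (p + 6)" using less_exp[of "p + 6"] by linarith
    also have "\<dots> \<le> (2 ^ (p + 6))\<^sup>2" by (rule self_le_power) auto
    also have "\<dots> \<le> length (f p)" using length_hard_words_ge[OF f(1)] .
    finally show "p \<le> length (f p)" .
  qed
  then show "\<exists>W. string_family W \<and> (\<forall>C\<ge>1. \<mu> \<in> o[along W](real \<circ> ell C))"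
    using measure_smallo_ell[OF \<mu> _ f] by blast
next
  fix W :: "str set" and C :: nat
  assume C: "1 \<le> C"
  show "(real \<circ> ell C) \<in> O[along W](real \<circ> slp_g)"
  proof (rule landau_o.bigI[of 8])
    show "eventually (\<lambda>w. norm ((real \<circ> ell C) w) \<le> 8 * norm ((real \<circ> slp_g) w)) (along W)"
      using eventually_along_nonempty
    proof (rule eventually_mono)
      fix w :: str assume "w \<noteq> []"
      from ell_le_slp_g[OF this C] show "norm ((real \<circ> ell C) w) \<le> 8 * norm ((real \<circ> slp_g) w)"
        by simp
    qed
  qed simp
  show "(real \<circ> ell C) \<in> \<Omega>[along W](real \<circ> nu C)"
  proof (rule landau_omega.bigI[of 1])
    show "eventually (\<lambda>w. norm ((real \<circ> ell C) w) \<ge> 1 * norm ((real \<circ> nu C) w)) (along W)"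
      using eventually_along_nonempty
    proof (rule eventually_mono)
      fix w :: str assume "w \<noteq> []"
      from nu_le_ell[OF this C] show "norm ((real \<circ> ell C) w) \<ge> 1 * norm ((real \<circ> nu C) w)"
        by simp
    qed
  qed simp
qed

end
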